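(* Let $a$ be a ($C^\infty$-)smooth boundary point of a $\mathbb C$-convex domain $D\subset\mathbb C^n$ and let $X\in\mathbb C^n\setminus\{0\}$ with $l_{a,X}<\infty$. Denote by $n_a$ the inner normal to $\partial D$ at $a$. Then there exist a neighborhood $U$ of $a$ and a constant $c>1$ such that $$c^{-1}d_D(z)\le d_D(z,X)^{l_{a,X}}\le c\,d_D(z),\qquad z\in D\cap U\cap n_a.$$
   Context: A domain $D\subset\mathbb C^n$ is $\mathbb C$-convex if every non-empty intersection of $D$ with a complex (affine) line is a simply connected domain (in particular connected). A smooth boundary point $a$ is one near which $\partial D$ is a $C^\infty$ hypersurface, i.e. there is a $C^\infty$ function $r$ near $a$ with $dr(a)\neq0$ and $D=\{r<0\}$ near $a$. The number $l_{a,X}$ is the order of contact at $a$ of $\partial D$ with the complex line through $a$ in direction $X$, i.e. the order of vanishing at $\zeta=0$ of $\zeta\mapsto r(a+\zeta X)$, $\zeta\in\mathbb C$ (possibly $\infty$). The inner normal $n_a$ is the real half-line starting at $a$ in the direction of the inner normal vector to $\partial D$ at $a$. $d_D(z)=\operatorname{dist}(z,\partial D)$ and $d_D(z,X)=\sup\{r>0: z+\lambda X\in D\text{ for all }\lambda\in\mathbb C,\ |\lambda|<r\}$. *)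

theory Defs
  imports "HOL-Analysis.Analysis"
begin

definition complex_line :: "(complex ^ 'n) set \<Rightarrow> bool" where
  "complex_line L \<longleftrightarrow> (\<exists>p v. v \<noteq> 0 \<and> L = range (\<lambda>\<zeta>. p + \<zeta> *s v))"

text \<open>
  Since \<open>D\<close> is open, \<open>D \<inter> L\<close> is automatically open in \<open>L\<close>; \<^const>\<open>simply_connected\<close> includes
  path-connectedness.
\<close>
definition C_convex_domain :: "(complex ^ 'n) set \<Rightarrow> bool" where
  "C_convex_domain D \<longleftrightarrow>
     open D \<and> connected D \<and> D \<noteq> {} \<and>
     (\<forall>L. complex_line L \<and> D \<inter> L \<noteq> {} \<longrightarrow> simply_connected (D \<inter> L))"

primrec iter_deriv ::
  "'a list \<Rightarrow> ('a::real_normed_vector \<Rightarrow> 'b::real_normed_vector) \<Rightarrow> 'a \<Rightarrow> 'b" where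
  "iter_deriv [] f = f"
| "iter_deriv (v # vs) f = iter_deriv vs (\<lambda>x. frechet_derivative f (at x) v)"

text \<open>
  On an open subset of a finite-dimensional space this is \<open>C\<^sup>\<infinity>\<close>-smoothness: every iterated
  directional derivative exists and is differentiable, hence continuous.
\<close>
definition smooth_on ::
  "'a::real_normed_vector set \<Rightarrow> ('a \<Rightarrow> 'b::real_normed_vector) \<Rightarrow> bool" where
  "smooth_on S f \<longleftrightarrow> (\<forall>vs. \<forall>x\<in>S. iter_deriv vs f differentiable (at x))"

text \<open>
  The least order of a non-vanishing derivative at \<open>p\<close>; it is \<open>\<infinity>\<close> (infimum of the empty set)
  if all derivatives vanish. A function on \<open>\<complex>\<close> is differentiated here as a function of two real
  variables.
\<close>
definition vanishing_order ::
  "('a::real_normed_vector \<Rightarrow> 'b::real_normed_vector) \<Rightarrow> 'a \<Rightarrow> enat" where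
  "vanishing_order f p = Inf {enat (length vs) | vs. iter_deriv vs f p \<noteq> 0}"

definition local_defining_function ::
  "(complex ^ 'n) set \<Rightarrow> complex ^ 'n \<Rightarrow> (complex ^ 'n \<Rightarrow> real) \<Rightarrow> bool" where
  "local_defining_function D a r \<longleftrightarrow>
     (\<exists>V. open V \<and> a \<in> V \<and> smooth_on V r \<and> D \<inter> V = {z \<in> V. r z < 0}) \<and>
     frechet_derivative r (at a) \<noteq> (\<lambda>_. 0)"

definition contact_order :: "(complex ^ 'n \<Rightarrow> real) \<Rightarrow> complex ^ 'n \<Rightarrow> complex ^ 'n \<Rightarrow> enat" where
  "contact_order r a X = vanishing_order (\<lambda>\<zeta>::complex. r (a + \<zeta> *s X)) 0"

text \<open>
  If \<open>D\<close> is \<open>{r < 0}\<close> near \<open>a\<close>, the inner normal direction at \<open>a\<close> is minus the gradient of \<open>r\<close>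
  for the real inner product \<open>Re \<langle>z, w\<rangle>\<close>.
\<close>
definition inner_normal :: "(complex ^ 'n \<Rightarrow> real) \<Rightarrow> complex ^ 'n \<Rightarrow> (complex ^ 'n) set" where
  "inner_normal r a = {a - t *\<^sub>R g | t g. 0 \<le> t \<and> GDERIV r a :> g}"

definition boundary_dist :: "(complex ^ 'n) set \<Rightarrow> complex ^ 'n \<Rightarrow> real" where
  "boundary_dist D z = infdist z (frontier D)"

text \<open>Extended-real valued, since \<open>D\<close> may contain a whole complex line.\<close>
definition directional_dist ::
  "(complex ^ 'n) set \<Rightarrow> complex ^ 'n \<Rightarrow> complex ^ 'n \<Rightarrow> ereal" where
  "directional_dist D z X =
     Sup (ereal ` {\<rho>. 0 < \<rho> \<and> (\<forall>\<mu>::complex. cmod \<mu> < \<rho> \<longrightarrow> z + \<mu> *s X \<in> D)})"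

end

theory Submission
  imports Defs "HOL-Complex_Analysis.Cauchy_Integral_Formula"
begin

text \<open>
  Put \<open>f \<zeta> = r (a + \<zeta> X)\<close>, which vanishes to order \<open>l\<close> at \<open>0\<close>, and \<open>z = a - t g\<close> with
  \<open>g\<close> the gradient at \<open>a\<close>; then \<open>d\<^sub>D(z)\<close> is comparable to \<open>t\<close>, and
  \<open>r (z + \<zeta> X) - f \<zeta>\<close> lies between two negative multiples of \<open>t\<close>. Since
  \<open>\<bar>f \<zeta>\<bar> \<le> C \<bar>\<zeta>\<bar>\<^sup>l\<close>, a disc of radius comparable to \<open>t\<^sup>1\<^sup>/\<^sup>l\<close> fits into \<open>D\<close>. For
  the converse it is enough to have one direction \<open>w\<close> with \<open>f (s w) \<ge> c s\<^sup>l\<close> for small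
  \<open>s \<ge> 0\<close>. By polarization some pure derivative of order \<open>l\<close> in a direction \<open>w\<close> does not
  vanish; \<open>w\<close> or \<open>- w\<close> is suitable unless \<open>l\<close> is even and that derivative is negative. In
  this last case \<open>D\<close> would approach \<open>a\<close> tangentially from both sides along \<open>w X\<close>, which
  is excluded by \<open>\<complex>\<close>-convexity.
\<close>

section \<open>Iterated directional derivatives\<close>

lemma smooth_on_differentiable: "smooth_on S f \<Longrightarrow> x \<in> S \<Longrightarrow> f differentiable (at x)"
  unfolding smooth_on_def by (metis iter_deriv.simps(1))

lemma smooth_on_has_derivative:
  "smooth_on S f \<Longrightarrow> x \<in> S \<Longrightarrow> (f has_derivative frechet_derivative f (at x)) (at x)"
  using smooth_on_differentiable frechet_derivative_works by blast

lemma smooth_on_frechet_derivative: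
  "smooth_on S f \<Longrightarrow> smooth_on S (\<lambda>x. frechet_derivative f (at x) v)"
  unfolding smooth_on_def by (metis iter_deriv.simps(2))

lemma smooth_on_iter_deriv: "smooth_on S f \<Longrightarrow> smooth_on S (iter_deriv vs f)"
  by (induction vs arbitrary: f) (auto dest: smooth_on_frechet_derivative)

lemma smooth_on_isCont: "smooth_on S f \<Longrightarrow> x \<in> S \<Longrightarrow> isCont f x"
  using smooth_on_differentiable differentiable_imp_continuous_within by blast

lemma iter_deriv_append: "iter_deriv (us @ vs) f = iter_deriv vs (iter_deriv us f)"
  by (induction us arbitrary: f) auto

text \<open>Agreement on an open set passes to the derivatives at all of its points, so the
  induction stays on \<open>S\<close>. Smoothness of \<open>f\<close> guarantees that the
  derivatives being compared exist.\<close>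

lemma iter_deriv_cong:
  assumes "open S" "smooth_on S f" "\<And>x. x \<in> S \<Longrightarrow> f x = g x" "x \<in> S"
  shows "iter_deriv vs f x = iter_deriv vs g x"
  using assms(2-)
proof (induction vs arbitrary: f g x)
  case (Cons v vs)
  have "frechet_derivative f (at y) v = frechet_derivative g (at y) v" if "y \<in> S" for y
    using frechet_derivative_transform_within_open[OF smooth_on_differentiable \<open>open S\<close>] Cons.prems that
    by metis
  then show ?case
    using Cons.IH[OF smooth_on_frechet_derivative[OF Cons.prems(1)]] Cons.prems(3) by auto
qed simp

text \<open>Each new direction is appended at the end, where it is differentiated last. The formula,
  known on all of the open set \<open>S\<close>, then identifies the next derivative, and this
  yields both the next formula and its differentiability.\<close>

lemma iter_deriv_linear:
  fixes f g :: "'a::real_normed_vector \<Rightarrow> 'b::real_normed_vector"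
  assumes "open S" "smooth_on S f" "smooth_on S g" "x \<in> S"
  shows "iter_deriv vs (\<lambda>x. f x + c *\<^sub>R g x) x = iter_deriv vs f x + c *\<^sub>R iter_deriv vs g x"
    and "iter_deriv vs (\<lambda>x. f x + c *\<^sub>R g x) differentiable (at x)"
proof -
  have *: "\<forall>x\<in>S. iter_deriv vs (\<lambda>x. f x + c *\<^sub>R g x) x = iter_deriv vs f x + c *\<^sub>R iter_deriv vs g x
      \<and> iter_deriv vs (\<lambda>x. f x + c *\<^sub>R g x) differentiable (at x)"
    using assms(2,3)
  proof (induction vs rule: rev_induct)
    case Nil
    then show ?case
      by (auto intro!: differentiable_add differentiable_scaleR intro: smooth_on_differentiable)
  next
    case (snoc v vs)
    let ?F = "iter_deriv vs f" and ?G = "iter_deriv vs g"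
    let ?H = "iter_deriv vs (\<lambda>x. f x + c *\<^sub>R g x)"
    have sm: "smooth_on S ?F" "smooth_on S ?G"
      using snoc.prems smooth_on_iter_deriv by auto
    have D: "(?H has_derivative (\<lambda>v. frechet_derivative ?F (at y) v + c *\<^sub>R frechet_derivative ?G (at y) v)) (at y)"
      if "y \<in> S" for y
    proof -
      have "((\<lambda>y. ?F y + c *\<^sub>R ?G y) has_derivative
          (\<lambda>v. frechet_derivative ?F (at y) v + c *\<^sub>R frechet_derivative ?G (at y) v)) (at y)"
        using sm that by (intro has_derivative_add has_derivative_scaleR_right smooth_on_has_derivative)
      from has_derivative_transform_within_open[OF this \<open>open S\<close> that] show ?thesis
        using snoc.IH[OF snoc.prems] by metis
    qed
    have E: "frechet_derivative ?H (at y) v = frechet_derivative ?F (at y) v + c *\<^sub>R frechet_derivative ?G (at y) v"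
      if "y \<in> S" for y
      using frechet_derivative_at[OF D[OF that]] by metis
    have "(\<lambda>y. frechet_derivative ?H (at y) v) differentiable at y" if "y \<in> S" for y
    proof -
      have "(\<lambda>y. frechet_derivative ?F (at y) v + c *\<^sub>R frechet_derivative ?G (at y) v) differentiable at y"
        by (intro differentiable_add differentiable_scaleR differentiable_const
            smooth_on_differentiable[OF _ that] smooth_on_frechet_derivative sm)
      then obtain F' where "((\<lambda>y. frechet_derivative ?F (at y) v + c *\<^sub>R frechet_derivative ?G (at y) v)
          has_derivative F') (at y)"
        unfolding differentiable_def by blast
      from has_derivative_transform_within_open[OF this \<open>open S\<close> that E[symmetric]] show ?thesis
        unfolding differentiable_def by blast
    qed
    then show ?case
      unfolding iter_deriv_append iter_deriv.simps using E by blast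
  qed
  show "iter_deriv vs (\<lambda>x. f x + c *\<^sub>R g x) x = iter_deriv vs f x + c *\<^sub>R iter_deriv vs g x"
    and "iter_deriv vs (\<lambda>x. f x + c *\<^sub>R g x) differentiable (at x)"
    using * assms(4) by auto
qed

section \<open>Mean values along lines and the symmetry of second derivatives\<close>

lemma has_real_derivative_line:
  fixes f :: "'a::real_normed_vector \<Rightarrow> real"
  assumes "f differentiable (at (x + t *\<^sub>R v))"
  shows "((\<lambda>t. f (x + t *\<^sub>R v)) has_real_derivative frechet_derivative f (at (x + t *\<^sub>R v)) v) (at t)"
proof -
  have "(f has_derivative frechet_derivative f (at (x + t *\<^sub>R v))) (at (x + t *\<^sub>R v))"
    using assms frechet_derivative_works by blast
  moreover have "((\<lambda>t. x + t *\<^sub>R v) has_derivative (\<lambda>h. h *\<^sub>R v)) (at t)"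
    by (auto intro!: derivative_eq_intros)
  ultimately have "((\<lambda>t. f (x + t *\<^sub>R v)) has_derivative
      (\<lambda>h. frechet_derivative f (at (x + t *\<^sub>R v)) (h *\<^sub>R v))) (at t)"
    using has_derivative_compose by blast
  moreover have "linear (frechet_derivative f (at (x + t *\<^sub>R v)))"
    using assms linear_frechet_derivative by blast
  ultimately show ?thesis
    by (simp add: has_field_derivative_def linear_scale mult.commute[of _ "frechet_derivative _ _ _"])
qed

lemma mvt_line:
  fixes f :: "'a::real_normed_vector \<Rightarrow> real"
  assumes "0 < s" "\<And>t. 0 \<le> t \<Longrightarrow> t \<le> s \<Longrightarrow> f differentiable (at (x + t *\<^sub>R v))"
  shows "\<exists>t>0. t < s \<and> f (x + s *\<^sub>R v) - f x = s * frechet_derivative f (at (x + t *\<^sub>R v)) v"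
  using MVT2[of 0 s "\<lambda>t. f (x + t *\<^sub>R v)" "\<lambda>t. frechet_derivative f (at (x + t *\<^sub>R v)) v"] assms
  by (auto intro: has_real_derivative_line)

text \<open>Two applications of the mean value theorem: along \<open>u\<close> to the difference
  \<open>?g\<close>, then along \<open>v\<close> to the derivative of \<open>f\<close> in direction
  \<open>u\<close>. The parallelogram has to lie in the region of smoothness for both.\<close>

lemma second_difference:
  fixes f :: "'a::real_normed_vector \<Rightarrow> real"
  assumes "0 < s" and sm: "smooth_on S f"
    and S: "\<And>p q. \<lbrakk>0 \<le> p; p \<le> s; 0 \<le> q; q \<le> s\<rbrakk> \<Longrightarrow> x + p *\<^sub>R u + q *\<^sub>R v \<in> S"
  shows "\<exists>p q. 0 \<le> p \<and> p \<le> s \<and> 0 \<le> q \<and> q \<le> s \<and>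
    f (x + s *\<^sub>R u + s *\<^sub>R v) - f (x + s *\<^sub>R u) - f (x + s *\<^sub>R v) + f x =
    s * s * iter_deriv [u, v] f (x + p *\<^sub>R u + q *\<^sub>R v)"
proof -
  let ?g = "\<lambda>y. f (y + s *\<^sub>R v) + (-1) *\<^sub>R f y"
  have dg: "(?g has_derivative (\<lambda>h. frechet_derivative f (at (y + s *\<^sub>R v)) h - frechet_derivative f (at y) h)) (at y)"
    if "y \<in> S" "y + s *\<^sub>R v \<in> S" for y
  proof -
    have "((\<lambda>y. y + s *\<^sub>R v) has_derivative (\<lambda>h. h)) (at y)"
      by (auto intro!: derivative_eq_intros)
    from has_derivative_compose[OF this smooth_on_has_derivative[OF sm that(2)]]
    show ?thesis
      by (auto intro!: derivative_eq_intros smooth_on_has_derivative[OF sm that(1)])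
  qed
  have S': "x + t *\<^sub>R u \<in> S" "x + t *\<^sub>R u + s *\<^sub>R v \<in> S" if "0 \<le> t" "t \<le> s" for t
    using S[of t 0] S[of t s] that assms(1) by auto
  obtain p where p: "p > 0" "p < s"
    "?g (x + s *\<^sub>R u) - ?g x = s * frechet_derivative ?g (at (x + p *\<^sub>R u)) u"
  proof -
    have "?g differentiable (at (x + t *\<^sub>R u))" if "0 \<le> t" "t \<le> s" for t
      using dg[OF S'[OF that]] unfolding differentiable_def by blast
    from mvt_line[OF assms(1) this] show ?thesis
      using that by blast
  qed
  let ?h = "\<lambda>y. frechet_derivative f (at y) u"
  have smh: "smooth_on S ?h"
    using sm smooth_on_frechet_derivative by blast
  have "frechet_derivative ?g (at (x + p *\<^sub>R u)) u = ?h (x + p *\<^sub>R u + s *\<^sub>R v) - ?h (x + p *\<^sub>R u)"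
    using frechet_derivative_at[OF dg[OF S'[of p]], symmetric] p by simp
  moreover obtain q where "q > 0" "q < s"
    "?h (x + p *\<^sub>R u + s *\<^sub>R v) - ?h (x + p *\<^sub>R u) = s * frechet_derivative ?h (at (x + p *\<^sub>R u + q *\<^sub>R v)) v"
  proof -
    have "?h differentiable (at (x + p *\<^sub>R u + t *\<^sub>R v))" if "0 \<le> t" "t \<le> s" for t
      using smooth_on_differentiable[OF smh S] p that by simp
    from mvt_line[OF assms(1) this] show ?thesis
      using that by blast
  qed
  ultimately show ?thesis
    using p by (intro exI[of _ p] exI[of _ q]) (auto simp: algebra_simps)
qed

text \<open>Schwarz's theorem: the second difference is symmetric in \<open>u\<close> and
  \<open>v\<close>, and divided by \<open>s * s\<close> it is a value of either mixed derivative
  close to \<open>x\<close>, so continuity forces the two values at \<open>x\<close> to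
  agree.\<close>

lemma iter_deriv_swap:
  fixes f :: "'a::real_normed_vector \<Rightarrow> real"
  assumes "open S" "smooth_on S f" "x \<in> S"
  shows "iter_deriv [u, v] f x = iter_deriv [v, u] f x"
proof (rule ccontr)
  assume ne: "\<not> ?thesis"
  define e where "e = \<bar>iter_deriv [u, v] f x - iter_deriv [v, u] f x\<bar> / 2"
  have "e > 0"
    using ne unfolding e_def by simp
  have near: "\<exists>d>0. \<forall>y. dist y x < d \<longrightarrow> \<bar>iter_deriv vs f y - iter_deriv vs f x\<bar> < e" for vs
    using smooth_on_isCont[OF smooth_on_iter_deriv[OF assms(2)] assms(3), of vs] \<open>e > 0\<close>
    unfolding continuous_at_eps_delta dist_real_def by blast
  obtain d1 where d1: "d1 > 0" "\<And>y. dist y x < d1 \<Longrightarrow> \<bar>iter_deriv [u, v] f y - iter_deriv [u, v] f x\<bar> < e"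
    using near by blast
  obtain d2 where d2: "d2 > 0" "\<And>y. dist y x < d2 \<Longrightarrow> \<bar>iter_deriv [v, u] f y - iter_deriv [v, u] f x\<bar> < e"
    using near by blast
  obtain d3 where d3: "d3 > 0" "\<And>y. dist y x < d3 \<Longrightarrow> y \<in> S"
    using assms(1,3) unfolding open_dist by blast
  define d where "d = min d1 (min d2 d3)"
  \<comment> \<open>The parallelogram with sides \<open>s u\<close> and \<open>s v\<close> then
    stays within distance \<open>d\<close> of \<open>x\<close>; the summand 1 covers
    \<open>u = v = 0\<close>.\<close>
  define s where "s = d / (norm u + norm v + 1)"
  have "d > 0"
    using d1 d2 d3 unfolding d_def by simp
  then have "s > 0"
    unfolding s_def by (intro divide_pos_pos) (auto simp: add_nonneg_pos)
  have close: "dist (x + p *\<^sub>R u + q *\<^sub>R v) x < d" if "0 \<le> p" "p \<le> s" "0 \<le> q" "q \<le> s" for p q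
  proof -
    have "dist (x + p *\<^sub>R u + q *\<^sub>R v) x = norm (p *\<^sub>R u + q *\<^sub>R v)"
      by (simp add: dist_norm algebra_simps)
    also have "\<dots> \<le> p * norm u + q * norm v"
      using norm_triangle_ineq[of "p *\<^sub>R u" "q *\<^sub>R v"] that by simp
    also have "\<dots> \<le> s * norm u + s * norm v"
      using that by (intro add_mono mult_right_mono) auto
    also have "\<dots> < s * (norm u + norm v + 1)"
      using \<open>s > 0\<close> by (simp add: algebra_simps)
    also have "\<dots> = d"
      unfolding s_def by (simp add: add_nonneg_eq_0_iff[THEN iffD1] add_nonneg_pos less_imp_neq[symmetric])
    finally show ?thesis .
  qed
  have close': "dist (x + p *\<^sub>R v + q *\<^sub>R u) x < d" if "0 \<le> p" "p \<le> s" "0 \<le> q" "q \<le> s" for p q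
    using close[of q p] that by (simp add: algebra_simps)
  let ?\<Delta> = "f (x + s *\<^sub>R u + s *\<^sub>R v) - f (x + s *\<^sub>R u) - f (x + s *\<^sub>R v) + f x"
  obtain p q where pq: "0 \<le> p" "p \<le> s" "0 \<le> q" "q \<le> s"
    "?\<Delta> = s * s * iter_deriv [u, v] f (x + p *\<^sub>R u + q *\<^sub>R v)"
    using second_difference[OF \<open>s > 0\<close> assms(2), of x u v] close d3 unfolding d_def by auto
  obtain p' q' where pq': "0 \<le> p'" "p' \<le> s" "0 \<le> q'" "q' \<le> s"
    "f (x + s *\<^sub>R v + s *\<^sub>R u) - f (x + s *\<^sub>R v) - f (x + s *\<^sub>R u) + f x
      = s * s * iter_deriv [v, u] f (x + p' *\<^sub>R v + q' *\<^sub>R u)"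
    using second_difference[OF \<open>s > 0\<close> assms(2), of x v u] close' d3 unfolding d_def by auto
  have "f (x + s *\<^sub>R v + s *\<^sub>R u) - f (x + s *\<^sub>R v) - f (x + s *\<^sub>R u) + f x = ?\<Delta>"
    by (simp add: algebra_simps)
  then have "iter_deriv [u, v] f (x + p *\<^sub>R u + q *\<^sub>R v) = iter_deriv [v, u] f (x + p' *\<^sub>R v + q' *\<^sub>R u)"
    using pq(5) pq'(5) \<open>s > 0\<close> by simp
  moreover have "\<bar>iter_deriv [u, v] f (x + p *\<^sub>R u + q *\<^sub>R v) - iter_deriv [u, v] f x\<bar> < e"
    using d1(2) close[OF pq(1-4)] unfolding d_def by simp
  moreover have "\<bar>iter_deriv [v, u] f (x + p' *\<^sub>R v + q' *\<^sub>R u) - iter_deriv [v, u] f x\<bar> < e"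
    using d2(2) close'[OF pq'(1-4)] unfolding d_def by simp
  ultimately show False
    unfolding e_def by (smt (verit) field_sum_of_halves)
qed

lemma iter_deriv_swap_Cons:
  fixes f :: "'a::real_normed_vector \<Rightarrow> real"
  assumes "open S" "smooth_on S f" "x \<in> S"
  shows "iter_deriv (u # v # vs) f x = iter_deriv (v # u # vs) f x"
proof -
  have "iter_deriv vs (iter_deriv [u, v] f) x = iter_deriv vs (iter_deriv [v, u] f) x"
    using assms by (intro iter_deriv_cong smooth_on_iter_deriv iter_deriv_swap) auto
  then show ?thesis
    by simp
qed

text \<open>Differentiating at \<open>s = 0\<close> extracts a mixed derivative from the pure derivatives in the
  directions \<open>u + s v\<close>; this is the polarization step.\<close>

lemma has_real_derivative_iter_deriv_replicate:
  fixes f :: "'a::real_normed_vector \<Rightarrow> real"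
  assumes "open S" "smooth_on S f" "x \<in> S"
  shows "((\<lambda>s. iter_deriv (replicate k (u + s *\<^sub>R v)) f x) has_real_derivative
    real k * iter_deriv (v # replicate (k - 1) u) f x) (at 0)"
  using assms(2)
proof (induction k arbitrary: f)
  case (Suc k)
  define fu where "fu = (\<lambda>y. frechet_derivative f (at y) u)"
  define fv where "fv = (\<lambda>y. frechet_derivative f (at y) v)"
  have sm: "smooth_on S fu" "smooth_on S fv"
    unfolding fu_def fv_def using Suc.prems smooth_on_frechet_derivative by auto
  have eq: "iter_deriv (replicate (Suc k) (u + s *\<^sub>R v)) f x =
      iter_deriv (replicate k (u + s *\<^sub>R v)) fu x + s * iter_deriv (replicate k (u + s *\<^sub>R v)) fv x" for s
  proof -
    have "frechet_derivative f (at y) (u + s *\<^sub>R v) = fu y + s *\<^sub>R fv y" if "y \<in> S" for y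
      using linear_frechet_derivative[OF smooth_on_differentiable[OF Suc.prems that]]
      unfolding fu_def fv_def by (simp add: linear_add linear_scale)
    then have "iter_deriv (replicate (Suc k) (u + s *\<^sub>R v)) f x =
        iter_deriv (replicate k (u + s *\<^sub>R v)) (\<lambda>y. fu y + s *\<^sub>R fv y) x"
      using iter_deriv_cong[OF assms(1) smooth_on_frechet_derivative[OF Suc.prems] _ assms(3)] by simp
    also have "\<dots> = iter_deriv (replicate k (u + s *\<^sub>R v)) fu x
        + s *\<^sub>R iter_deriv (replicate k (u + s *\<^sub>R v)) fv x"
      by (rule iter_deriv_linear(1)[OF assms(1) sm assms(3)])
    finally show ?thesis
      by simp
  qed
  \<comment> \<open>Leibniz rule at \<open>s = 0\<close>: the \<open>fu\<close> part gives
    \<open>k\<close> terms in which \<open>v\<close> has to be moved in front of one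
    \<open>u\<close>, the \<open>fv\<close> part gives one more. For \<open>k = 0\<close> the
    truncated \<open>k - 1\<close> is harmless because of the factor \<open>real k\<close>.\<close>
  have "real k * iter_deriv (v # replicate (k - 1) u) fu x + iter_deriv (replicate k u) fv x
      = real (Suc k) * iter_deriv (v # replicate (Suc k - 1) u) f x"
  proof (cases k)
    case (Suc m)
    then show ?thesis
      using iter_deriv_swap_Cons[OF assms(1) Suc.prems assms(3), of u v "replicate m u"]
      unfolding fu_def fv_def by (simp add: algebra_simps)
  qed (simp add: fv_def)
  then show ?case
    unfolding eq
    by (auto intro!: derivative_eq_intros Suc.IH[OF sm(1)] Suc.IH[OF sm(2)])
qed simp

text \<open>All pure derivatives in the directions \<open>u + s v\<close> vanish, hence so does
  their derivative at \<open>s = 0\<close>. Thus the derivative of \<open>f\<close> along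
  \<open>v\<close> has vanishing pure derivatives of one order less, and the induction on
  \<open>vs\<close> applies to it.\<close>

lemma iter_deriv_polarization:
  fixes f :: "'a::real_normed_vector \<Rightarrow> real"
  assumes "open S" "smooth_on S f" "x \<in> S"
    and "\<And>w. iter_deriv (replicate (length vs) w) f x = 0"
  shows "iter_deriv vs f x = 0"
  using assms(2,4)
proof (induction vs arbitrary: f)
  case Nil
  then show ?case by simp
next
  case (Cons v vs)
  have "iter_deriv (v # replicate (length vs) u) f x = 0" for u
  proof -
    have "((\<lambda>s. 0) has_real_derivative real (Suc (length vs)) * iter_deriv (v # replicate (length vs) u) f x) (at 0)"
      using has_real_derivative_iter_deriv_replicate[OF assms(1) Cons.prems(1) assms(3), of "Suc (length vs)" u v]
        Cons.prems(2) by simp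
    then have "real (Suc (length vs)) * iter_deriv (v # replicate (length vs) u) f x = 0"
      using DERIV_const DERIV_unique by blast
    then show ?thesis by simp
  qed
  then show ?case
    using Cons.IH[OF smooth_on_frechet_derivative[OF Cons.prems(1)]] by simp
qed

section \<open>Taylor estimates at a point where all lower derivatives vanish\<close>

text \<open>Taylor's formula with Lagrange remainder: the lower terms vanish, and \<open>B\<close>
  is the derivative of order \<open>l\<close> at an intermediate point, close to its value at
  \<open>x\<close> by continuity. Negative \<open>s\<close> is included, which matters for the
  distinction by the parity of \<open>l\<close>.\<close>

lemma leading_term_line:
  fixes f :: "'a::real_normed_vector \<Rightarrow> real"
  assumes "open S" "smooth_on S f" "x \<in> S"
    and low: "\<And>vs. length vs < l \<Longrightarrow> iter_deriv vs f x = 0"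
    and "0 < e"
  shows "\<exists>d>0. \<forall>s. \<bar>s\<bar> < d \<longrightarrow>
    (\<exists>B. \<bar>B - iter_deriv (replicate l w) f x\<bar> < e \<and> f (x + s *\<^sub>R w) = B / fact l * s ^ l)"
proof -
  define g where "g = (\<lambda>m t. iter_deriv (replicate m w) f (x + t *\<^sub>R w))"
  have "((\<lambda>t. x + t *\<^sub>R w) \<longlongrightarrow> x + 0 *\<^sub>R w) (at 0)"
    by (intro tendsto_intros)
  then have lim: "((\<lambda>t. x + t *\<^sub>R w) \<longlongrightarrow> x) (at 0)"
    by simp
  have "isCont (iter_deriv (replicate l w) f) x"
    using smooth_on_isCont[OF smooth_on_iter_deriv[OF assms(2)] assms(3)] .
  then have "((\<lambda>t. g l t) \<longlongrightarrow> g l 0) (at 0)"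
    unfolding g_def by (rule isCont_tendsto_compose[of _ "iter_deriv (replicate l w) f", THEN tendsto_eq_rhs]) (use lim in auto)
  from tendstoD[OF this \<open>0 < e\<close>] have "\<forall>\<^sub>F t in at 0. \<bar>g l t - g l 0\<bar> < e"
    by (simp add: dist_real_def)
  moreover have "\<forall>\<^sub>F t in at 0. x + t *\<^sub>R w \<in> S"
    using topological_tendstoD[OF lim assms(1,3)] .
  ultimately have "\<forall>\<^sub>F t in at 0. x + t *\<^sub>R w \<in> S \<and> \<bar>g l t - g l 0\<bar> < e"
    by (rule eventually_conj[rotated])
  then obtain d where d0: "d > 0"
    "\<And>t. \<lbrakk>t \<noteq> 0; \<bar>t\<bar> < d\<rbrakk> \<Longrightarrow> x + t *\<^sub>R w \<in> S \<and> \<bar>g l t - g l 0\<bar> < e"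
    unfolding eventually_at by auto
  have d: "x + t *\<^sub>R w \<in> S \<and> \<bar>g l t - g l 0\<bar> < e" if "\<bar>t\<bar> < d" for t
    using d0(2)[of t] that assms(3,5) by (cases "t = 0") auto
  have "\<exists>B. \<bar>B - iter_deriv (replicate l w) f x\<bar> < e \<and> f (x + s *\<^sub>R w) = B / fact l * s ^ l" if s: "\<bar>s\<bar> < d" for s
  proof -
    have "(g m has_real_derivative g (Suc m) t) (at t)" if "\<bar>t\<bar> \<le> \<bar>s\<bar>" for m t
    proof -
      have "(iter_deriv (replicate m w) f) differentiable (at (x + t *\<^sub>R w))"
        using smooth_on_differentiable[OF smooth_on_iter_deriv[OF assms(2)]] d[of t] that s by simp
      from has_real_derivative_line[OF this] show ?thesis
        unfolding g_def replicate_append_same[symmetric] replicate_Suc iter_deriv_append by simp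
    qed
    then obtain t where t: "\<bar>t\<bar> \<le> \<bar>s\<bar>"
      "f (x + s *\<^sub>R w) = (\<Sum>m<l. g m 0 / fact m * s ^ m) + g l t / fact l * s ^ l"
      using Maclaurin_bi_le[of g "\<lambda>t. f (x + t *\<^sub>R w)" l s] unfolding g_def by auto
    have "(\<Sum>m<l. g m 0 / fact m * s ^ m) = 0"
      using low unfolding g_def by (intro sum.neutral) simp
    then show ?thesis
      using t d[of t] s unfolding g_def by (intro exI[of _ "g l t"]) (auto simp: g_def)
  qed
  then show ?thesis
    using d0(1) by blast
qed

text \<open>This bound is uniform over all directions. Induction on \<open>k\<close>: the
  derivatives along the basis vectors vanish to one order less, and the mean value theorem on the
  segment from \<open>x\<close> to \<open>y\<close> contributes the remaining factor
  \<open>dist x y\<close>.\<close>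

lemma abs_le_power_of_iter_deriv_zero:
  fixes f :: "'a::euclidean_space \<Rightarrow> real"
  assumes "open S" "smooth_on S f" "x \<in> S"
    and "\<And>vs. length vs < k \<Longrightarrow> iter_deriv vs f x = 0"
  shows "\<exists>C d. 0 \<le> C \<and> 0 < d \<and> (\<forall>y. dist x y < d \<longrightarrow> \<bar>f y\<bar> \<le> C * dist x y ^ k)"
  using assms(2,4)
proof (induction k arbitrary: f)
  case 0
  have "isCont f x"
    using smooth_on_isCont 0 assms by blast
  then obtain d where "d > 0" "\<forall>y. dist y x < d \<longrightarrow> dist (f y) (f x) < 1"
    unfolding continuous_at_eps_delta using zero_less_one by blast
  then have "\<forall>y. dist x y < d \<longrightarrow> \<bar>f y\<bar> \<le> (\<bar>f x\<bar> + 1) * dist x y ^ 0"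
    by (force simp: dist_real_def dist_commute)
  then show ?case
    using \<open>d > 0\<close> by (intro exI[of _ "\<bar>f x\<bar> + 1"] exI[of _ d]) auto
next
  case (Suc k)
  have "\<exists>C d. 0 \<le> C \<and> 0 < d \<and> (\<forall>y. dist x y < d \<longrightarrow> \<bar>frechet_derivative f (at y) b\<bar> \<le> C * dist x y ^ k)" for b
  proof (rule Suc.IH[OF smooth_on_frechet_derivative[OF Suc.prems(1)]])
    show "iter_deriv vs (\<lambda>y. frechet_derivative f (at y) b) x = 0" if "length vs < k" for vs
      using Suc.prems(2)[of "b # vs"] that by simp
  qed
  then obtain C d where Cd: "\<And>b. 0 \<le> C b" "\<And>b. 0 < d b"
    "\<And>b y. dist x y < d b \<Longrightarrow> \<bar>frechet_derivative f (at y) b\<bar> \<le> C b * dist x y ^ k"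
    by metis
  obtain d0 where d0: "d0 > 0" "ball x d0 \<subseteq> S"
    using assms(1,3) open_contains_ball by blast
  \<comment> \<open>The basis is finite, so the radii for its directions have a positive
    minimum.\<close>
  define D where "D = min d0 (Min (d ` Basis))"
  have D: "D > 0" "D \<le> d0" "\<And>b. b \<in> Basis \<Longrightarrow> D \<le> d b"
    unfolding D_def using d0 Cd(2) by (auto simp: min.coboundedI2)
  have "\<bar>f y\<bar> \<le> (\<Sum>b\<in>Basis. C b) * dist x y ^ Suc k" if y: "dist x y < D" for y
  proof -
    define h where "h = y - x"
    have seg: "dist x (x + t *\<^sub>R h) \<le> dist x y" if "0 \<le> t" "t \<le> 1" for t
      using that mult_left_le_one_le[of "norm h" t] unfolding h_def by (simp add: dist_norm norm_minus_commute)
    have inS: "x + t *\<^sub>R h \<in> S" if "0 \<le> t" "t \<le> 1" for t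
      using seg[OF that] y D(2) d0(2) by (auto simp: subset_iff)
    obtain t where t: "0 < t" "t < 1" "f (x + h) - f x = frechet_derivative f (at (x + t *\<^sub>R h)) h"
      using mvt_line[of 1 f x h] smooth_on_differentiable[OF Suc.prems(1) inS] by auto
    define z where "z = x + t *\<^sub>R h"
    have z: "z \<in> S" "dist x z \<le> dist x y"
      using inS[of t] seg[of t] t unfolding z_def by auto
    have lin: "linear (frechet_derivative f (at z))"
      using linear_frechet_derivative[OF smooth_on_differentiable[OF Suc.prems(1) z(1)]] .
    have "f y = frechet_derivative f (at z) h"
      using t(3) Suc.prems(2)[of "[]"] unfolding h_def z_def by simp
    also have "\<dots> = (\<Sum>b\<in>Basis. (h \<bullet> b) * frechet_derivative f (at z) b)"
    proof -
      have "frechet_derivative f (at z) h = frechet_derivative f (at z) (\<Sum>b\<in>Basis. (h \<bullet> b) *\<^sub>R b)"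
        by (simp only: euclidean_representation)
      also have "\<dots> = (\<Sum>b\<in>Basis. (h \<bullet> b) * frechet_derivative f (at z) b)"
        by (simp only: linear_sum[OF lin] linear_scale[OF lin] real_scaleR_def)
      finally show ?thesis .
    qed
    finally have "\<bar>f y\<bar> \<le> (\<Sum>b\<in>Basis. \<bar>(h \<bullet> b) * frechet_derivative f (at z) b\<bar>)"
      by (simp add: sum_abs)
    also have "\<dots> \<le> (\<Sum>b\<in>Basis. dist x y * (C b * dist x y ^ k))"
    proof (rule sum_mono)
      fix b :: 'a assume b: "b \<in> Basis"
      have "\<bar>h \<bullet> b\<bar> \<le> dist x y"
        using Basis_le_norm[OF b, of h] unfolding h_def by (simp add: dist_norm norm_minus_commute)
      moreover have "\<bar>frechet_derivative f (at z) b\<bar> \<le> C b * dist x z ^ k"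
        using Cd(3) z(2) y D(3)[OF b] by (meson le_less_trans less_le_trans)
      moreover have "C b * dist x z ^ k \<le> C b * dist x y ^ k"
        using Cd(1) z(2) by (intro mult_left_mono power_mono) auto
      ultimately show "\<bar>(h \<bullet> b) * frechet_derivative f (at z) b\<bar> \<le> dist x y * (C b * dist x y ^ k)"
        unfolding abs_mult by (intro mult_mono) auto
    qed
    also have "\<dots> = (\<Sum>b\<in>Basis. C b) * dist x y ^ Suc k"
      by (simp add: sum_distrib_left sum_distrib_right algebra_simps)
    finally show ?thesis .
  qed
  then show ?case
    using D(1) Cd(1) by (intro exI[of _ "\<Sum>b\<in>Basis. C b"] exI[of _ D]) (auto intro: sum_nonneg)
qed

section \<open>Winding numbers on both sides of a segment\<close>

text \<open>The two points lie on opposite sides of the segment, so the winding numbers of the closed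
  curve around them differ by one.\<close>

lemma winding_number_crossing:
  fixes \<gamma> :: "real \<Rightarrow> complex"
  assumes "path \<gamma>" "pathstart \<gamma> = of_real s" "pathfinish \<gamma> = - of_real s" "0 < s"
    and "0 < y" "y < s" and away: "\<And>z. z \<in> path_image \<gamma> \<Longrightarrow> y < cmod z"
    and "winding_number (\<gamma> +++ linepath (- of_real s) (of_real s)) (\<i> * of_real y) = 0"
  shows "winding_number (\<gamma> +++ linepath (- of_real s) (of_real s)) (- \<i> * of_real y) \<noteq> 0"
proof
  define S :: complex where "S = of_real s"
  define p where "p = \<i> * complex_of_real y"
  define q where "q = - \<i> * complex_of_real y"
  define top where "top = linepath (- S) S"
  \<comment> \<open>\<open>low1\<close> and \<open>low2\<close> form a detour from
    \<open>- S\<close> to \<open>S\<close> through \<open>- \<i> * S\<close>, passing below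
    \<open>q\<close>. Unlike the real segment, it does not meet the segment from \<open>p\<close> to
    \<open>q\<close>.\<close>
  define low1 where "low1 = linepath (- S) (- \<i> * S)"
  define low2 where "low2 = linepath (- \<i> * S) S"
  let ?low = "low1 +++ low2"
  assume q0: "winding_number (\<gamma> +++ linepath (- of_real s) (of_real s)) (- \<i> * of_real y) = 0"
  have seg: "Re z = 0 \<and> \<bar>Im z\<bar> \<le> y" if zs: "z \<in> closed_segment p q" for z
  proof -
    obtain u where u: "0 \<le> u" "u \<le> 1" "z = (1 - u) *\<^sub>R p + u *\<^sub>R q"
      using zs unfolding closed_segment_def by auto
    have "Re z = 0" "Im z = (1 - 2 * u) * y"
      unfolding u(3) p_def q_def by (simp_all add: algebra_simps)
    moreover have "\<bar>1 - 2 * u\<bar> * y \<le> 1 * y"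
      using u \<open>0 < y\<close> by (intro mult_right_mono) auto
    ultimately show ?thesis
      using \<open>0 < y\<close> by (simp add: abs_mult)
  qed
  \<comment> \<open>On the detour this sum equals \<open>s\<close>, while between \<open>p\<close>
    and \<open>q\<close> it is at most \<open>y < s\<close>.\<close>
  have low: "\<bar>Re z\<bar> + \<bar>Im z\<bar> = s" if zl: "z \<in> path_image low1 \<union> path_image low2" for z
  proof -
    obtain u where u: "0 \<le> u" "u \<le> 1" "z = (1 - u) *\<^sub>R (- S) + u *\<^sub>R (- \<i> * S) \<or> z = (1 - u) *\<^sub>R (- \<i> * S) + u *\<^sub>R S"
      using zl unfolding low1_def low2_def path_image_linepath closed_segment_def by auto
    have "Re z = - ((1 - u) * s) \<and> Im z = - (u * s) \<or> Re z = u * s \<and> Im z = - ((1 - u) * s)"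
      using u(3) unfolding S_def by (elim disjE) simp_all
    moreover have "0 \<le> (1 - u) * s" "0 \<le> u * s" "(1 - u) * s = s - u * s"
      using u(1,2) \<open>0 < s\<close> by (auto simp: algebra_simps)
    ultimately show ?thesis
      by auto
  qed
  have pq: "p \<in> closed_segment p q" "q \<in> closed_segment p q"
    by auto
  have off_\<gamma>: "closed_segment p q \<inter> path_image \<gamma> = {}"
  proof -
    have "cmod z \<le> y" if "z \<in> closed_segment p q" for z
      using seg[OF that] cmod_le[of z] by linarith
    then show ?thesis
      using away by force
  qed
  have off_low: "closed_segment p q \<inter> (path_image low1 \<union> path_image low2) = {}"
    using low seg \<open>y < s\<close> by force
  have paths: "path low1" "path low2" "path top"
    unfolding low1_def low2_def top_def by auto
  have ends: "pathfinish low1 = pathstart low2" "pathfinish \<gamma> = pathstart ?low" "pathfinish ?low = pathstart \<gamma>"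
    "pathfinish \<gamma> = pathstart top"
    unfolding low1_def low2_def top_def S_def using assms(2,3) by auto
  have join_low: "winding_number (\<gamma> +++ ?low) z =
      winding_number \<gamma> z + (winding_number low1 z + winding_number low2 z)" if "z \<in> closed_segment p q" for z
  proof -
    have "z \<notin> path_image \<gamma>" "z \<notin> path_image low1" "z \<notin> path_image low2"
      using off_\<gamma> off_low that by auto
    then show ?thesis
      using assms(1) paths ends by (simp add: winding_number_join path_image_join)
  qed
  have "winding_number (\<gamma> +++ ?low) p = winding_number (\<gamma> +++ ?low) q"
  proof (rule winding_number_eq[of _ _ "closed_segment p q"])
    show "closed_segment p q \<inter> path_image (\<gamma> +++ ?low) = {}"
      using off_\<gamma> off_low ends by (auto simp: path_image_join)
  qed (use assms(1) paths ends in auto)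
  then have eq: "winding_number \<gamma> p + winding_number low1 p + winding_number low2 p =
      winding_number \<gamma> q + winding_number low1 q + winding_number low2 q"
    using join_low pq by (simp add: add.assoc)
  have off_top: "p \<notin> path_image top" "q \<notin> path_image top"
    using \<open>0 < y\<close> unfolding p_def q_def top_def S_def path_image_linepath closed_segment_def
    by (auto simp: complex_eq_iff)
  have \<gamma>0: "winding_number \<gamma> p + winding_number top p = 0" "winding_number \<gamma> q + winding_number top q = 0"
  proof -
    have "winding_number \<gamma> z + winding_number top z = winding_number (\<gamma> +++ top) z" if "z \<in> {p, q}" for z
      using that off_\<gamma> off_top pq paths(3) ends(4) assms(1) by (subst winding_number_join) auto
    moreover have "winding_number (\<gamma> +++ top) p = 0" "winding_number (\<gamma> +++ top) q = 0"
      unfolding p_def q_def top_def S_def by (fact assms(8), fact q0)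
    ultimately show "winding_number \<gamma> p + winding_number top p = 0" "winding_number \<gamma> q + winding_number top q = 0"
      by auto
  qed
  have rev: "winding_number (linepath S (- S)) z = - winding_number top z" if "z \<notin> path_image top" for z
    using winding_number_reversepath[OF paths(3) that] unfolding top_def by simp
  \<comment> \<open>The reversed segment and the detour bound the triangle with vertices
    \<open>S\<close>, \<open>- S\<close>, \<open>- \<i> * S\<close>; \<open>p\<close> lies outside
    it and \<open>q\<close> inside.\<close>
  have tri: "winding_number (linepath S (- S) +++ ?low) z =
      - winding_number top z + (winding_number low1 z + winding_number low2 z)" if "z \<in> {p, q}" for z
  proof -
    have z: "z \<notin> path_image top" "z \<notin> path_image low1" "z \<notin> path_image low2"
      using off_top off_low pq that by auto
    then have "z \<notin> path_image (linepath S (- S))"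
      unfolding top_def by (simp add: closed_segment_commute)
    moreover have "pathfinish (linepath S (- S)) = pathstart ?low"
      unfolding low1_def by simp
    ultimately have "winding_number (linepath S (- S) +++ ?low) z = winding_number (linepath S (- S)) z + winding_number ?low z"
      using paths ends z by (intro winding_number_join) (auto simp: path_image_join)
    then show ?thesis
      using rev[OF z(1)] winding_number_join[of low1 z low2] paths ends z by simp
  qed
  have "winding_number (linepath S (- S) +++ ?low) p = 0"
  proof (rule winding_number_zero_outside[of _ "{z. Im z \<le> 0}"])
    have cv: "convex {z. Im z \<le> 0}"
      by (rule convex_halfspace_Im_le)
    have "closed_segment S (- S) \<subseteq> {z. Im z \<le> 0}" "closed_segment (- S) (- \<i> * S) \<subseteq> {z. Im z \<le> 0}"
      "closed_segment (- \<i> * S) S \<subseteq> {z. Im z \<le> 0}"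
      using \<open>0 < s\<close> by (intro closed_segment_subset cv; simp add: S_def)+
    then show "path_image (linepath S (- S) +++ ?low) \<subseteq> {z. Im z \<le> 0}"
      unfolding low1_def low2_def by (auto simp: path_image_join)
  qed (use \<open>0 < y\<close> in \<open>auto simp: p_def low1_def low2_def convex_halfspace_Im_le\<close>)
  \<comment> \<open>The triangle is run through counterclockwise, so \<open>q\<close> is strictly to
    the left of each side and every side contributes a positive real part.\<close>
  moreover have "0 < Re (winding_number (linepath S (- S)) q)"
    "0 < Re (winding_number low1 q)" "0 < Re (winding_number low2 q)"
    unfolding low1_def low2_def q_def S_def using assms(4-6)
    by (intro winding_number_linepath_pos_lt; simp)+
  moreover have "winding_number low1 p + winding_number low2 p = winding_number top p"
    using calculation(1) tri[of p] by (simp add: algebra_simps)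
  \<comment> \<open>By \<open>eq\<close> and \<open>\<gamma>0\<close> the triangle has the same
    winding number about \<open>q\<close> as about \<open>p\<close>, namely 0, against the three
    positive contributions.\<close>
  then have "winding_number low1 q + winding_number low2 q = winding_number top q"
    using eq \<gamma>0 by (metis (no_types, opaque_lifting) add.assoc add_left_cancel)
  then have "Re (winding_number low1 q) + Re (winding_number low2 q) = - Re (winding_number (linepath S (- S)) q)"
    using rev[OF off_top(2)] by (metis minus_minus uminus_complex.sel(1) plus_complex.sel(1))
  ultimately show False
    by linarith
qed

section \<open>Restriction to complex lines\<close>

lemma norm_vector_smult: "norm (c *s v :: complex ^ 'n) = cmod c * norm v"
  unfolding norm_vec_def by (simp add: norm_mult L2_set_right_distrib)

lemma of_real_vector_smult: "of_real t *s (v :: complex ^ 'n) = t *\<^sub>R v"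
  by (simp add: vec_eq_iff) (simp add: scaleR_conv_of_real)

lemma bounded_linear_vector_smult: "bounded_linear (\<lambda>c. c *s (v :: complex ^ 'n))"
proof (rule bounded_linear_intro[where K = "norm v"])
  show "(r *\<^sub>R c) *s v = r *\<^sub>R (c *s v)" for r c
    by (simp add: vec_eq_iff)
qed (auto simp: norm_vector_smult vector_sadd_rdistrib)

text \<open>For \<open>v\<close> the gradient this says that \<open>\<i> *s v\<close> is tangent to
  the boundary; complex lines will be tilted in this direction.\<close>

lemma inner_imaginary_smult: "(\<i> *s v) \<bullet> (v :: complex ^ 'n) = 0"
  by (simp add: inner_vec_def inner_complex_def algebra_simps)

lemma has_derivative_affine:
  "bounded_linear L \<Longrightarrow> ((\<lambda>x. p + L x) has_derivative L) (at x)"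
  using has_derivative_add[OF has_derivative_const bounded_linear_imp_has_derivative] by fastforce

lemma open_vimage_affine: "bounded_linear L \<Longrightarrow> open S \<Longrightarrow> open ((\<lambda>x. p + L x) -` S)"
  by (intro open_vimage continuous_on_add continuous_on_const linear_continuous_on)

text \<open>The derivative of the affine substitution is the constant map \<open>L\<close>, so the
  chain rule produces no further terms at any order.\<close>

lemma iter_deriv_affine:
  fixes f :: "'a::real_normed_vector \<Rightarrow> 'b::real_normed_vector"
    and L :: "'c::real_normed_vector \<Rightarrow> 'a"
  assumes "open S" "smooth_on S f" "bounded_linear L" "p + L x \<in> S"
  shows "iter_deriv vs (\<lambda>x. f (p + L x)) x = iter_deriv (map L vs) f (p + L x)"
  using assms(4)
proof (induction vs arbitrary: x rule: rev_induct)
  case (snoc v vs)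
  let ?F = "iter_deriv (map L vs) f"
  define T where "T = (\<lambda>x. p + L x) -` S"
  have "open T"
    unfolding T_def using assms(1,3) open_vimage_affine by blast
  from has_derivative_compose[OF has_derivative_affine[OF assms(3)] smooth_on_has_derivative[OF smooth_on_iter_deriv[OF assms(2)] snoc.prems]]
  have "((\<lambda>x. ?F (p + L x)) has_derivative (\<lambda>h. frechet_derivative ?F (at (p + L x)) (L h))) (at x)" .
  then have "(iter_deriv vs (\<lambda>x. f (p + L x)) has_derivative
      (\<lambda>h. frechet_derivative ?F (at (p + L x)) (L h))) (at x)"
    by (rule has_derivative_transform_within_open[OF _ \<open>open T\<close>]) (use snoc in \<open>auto simp: T_def\<close>)
  from frechet_derivative_at[OF this, symmetric] show ?case
    by (simp add: iter_deriv_append)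
qed simp

lemma smooth_on_affine:
  fixes f :: "'a::real_normed_vector \<Rightarrow> 'b::real_normed_vector"
    and L :: "'c::real_normed_vector \<Rightarrow> 'a"
  assumes "open S" "smooth_on S f" "bounded_linear L"
  shows "smooth_on ((\<lambda>x. p + L x) -` S) (\<lambda>x. f (p + L x))"
  unfolding smooth_on_def
proof (intro allI ballI)
  fix vs x
  assume x: "x \<in> (\<lambda>x. p + L x) -` S"
  have "open ((\<lambda>x. p + L x) -` S)"
    using assms(1,3) open_vimage_affine by blast
  moreover from has_derivative_compose[OF has_derivative_affine[OF assms(3)]
      smooth_on_has_derivative[OF smooth_on_iter_deriv[OF assms(2)]]]
  have "((\<lambda>x. iter_deriv (map L vs) f (p + L x)) has_derivative
      (\<lambda>h. frechet_derivative (iter_deriv (map L vs) f) (at (p + L x)) (L h))) (at x)"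
    using x by auto
  ultimately have "(iter_deriv vs (\<lambda>x. f (p + L x)) has_derivative
      (\<lambda>h. frechet_derivative (iter_deriv (map L vs) f) (at (p + L x)) (L h))) (at x)"
    using x iter_deriv_affine[OF assms]
    by (elim has_derivative_transform_within_open) auto
  then show "iter_deriv vs (\<lambda>x. f (p + L x)) differentiable at x"
    unfolding differentiable_def by blast
qed

lemma vanishing_order_eq_enatD:
  assumes "vanishing_order f p = enat l"
  shows "\<exists>vs. length vs = l \<and> iter_deriv vs f p \<noteq> 0"
    and "\<And>vs. length vs < l \<Longrightarrow> iter_deriv vs f p = 0"
proof -
  let ?A = "{enat (length vs) | vs. iter_deriv vs f p \<noteq> 0}"
  have A: "Inf ?A = enat l"
    using assms unfolding vanishing_order_def .
  \<comment> \<open>A finite infimum excludes the empty set, whose infimum is infinite; a nonempty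
    set of extended naturals contains its infimum.\<close>
  have "?A \<noteq> {}"
  proof
    assume "?A = {}"
    with A have "Inf {} = enat l"
      by (simp only:)
    then show False
      by (simp add: top_enat_def)
  qed
  then have "Inf ?A \<in> ?A"
    unfolding Inf_enat_def by (metis (no_types, lifting) LeastI_ex all_not_in_conv)
  then show "\<exists>vs. length vs = l \<and> iter_deriv vs f p \<noteq> 0"
    unfolding A by auto
  show "iter_deriv vs f p = 0" if "length vs < l" for vs
  proof (rule ccontr)
    assume "iter_deriv vs f p \<noteq> 0"
    then have "Inf ?A \<le> enat (length vs)"
      by (intro Inf_lower) blast
    then show False
      using A that by simp
  qed
qed

text \<open>Moves the slice of \<open>D\<close> into the plane, where winding numbers are available.
  A coordinate in which \<open>v\<close> does not vanish gives the continuous inverse of the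
  parametrization.\<close>

lemma simply_connected_line_parameters:
  assumes "C_convex_domain D" "v \<noteq> 0" "p + \<zeta>\<^sub>0 *s v \<in> D"
  shows "simply_connected {\<zeta>. p + \<zeta> *s v \<in> D}"
proof -
  define L where "L = range (\<lambda>\<zeta>. p + \<zeta> *s v)"
  obtain k where k: "v $ k \<noteq> 0"
    using assms(2) by (auto simp: vec_eq_iff)
  have "complex_line L"
    unfolding complex_line_def L_def using assms(2) by blast
  then have "simply_connected (D \<inter> L)"
    using assms(1,3) unfolding C_convex_domain_def L_def by blast
  moreover have "{\<zeta>. p + \<zeta> *s v \<in> D} homeomorphic D \<inter> L"
  proof (rule homeomorphicI[of "\<lambda>\<zeta>. p + \<zeta> *s v" _ _ "\<lambda>z. (z $ k - p $ k) / v $ k"])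
    show "continuous_on {\<zeta>. p + \<zeta> *s v \<in> D} (\<lambda>\<zeta>. p + \<zeta> *s v)"
      by (intro continuous_intros bounded_linear.continuous_on[OF bounded_linear_vector_smult])
    show "continuous_on (D \<inter> L) (\<lambda>z. (z $ k - p $ k) / v $ k)"
      using k by (intro continuous_intros) auto
    have inv: "((p + \<zeta> *s v) $ k - p $ k) / v $ k = \<zeta>" for \<zeta>
      using k by simp
    show "((p + \<zeta> *s v) $ k - p $ k) / v $ k = \<zeta>" for \<zeta>
      by (rule inv)
    show "p + ((z $ k - p $ k) / v $ k) *s v = z" if "z \<in> D \<inter> L" for z
      using that inv unfolding L_def by auto
    show "(\<lambda>\<zeta>. p + \<zeta> *s v) ` {\<zeta>. p + \<zeta> *s v \<in> D} = D \<inter> L"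
      unfolding L_def by auto
    then show "(\<lambda>z. (z $ k - p $ k) / v $ k) ` (D \<inter> L) = {\<zeta>. p + \<zeta> *s v \<in> D}"
      by (simp add: image_image flip: \<open>(\<lambda>\<zeta>. p + \<zeta> *s v) ` {\<zeta>. p + \<zeta> *s v \<in> D} = D \<inter> L\<close>) (use k in simp)
  qed
  ultimately show ?thesis
    using homeomorphic_simply_connected_eq by blast
qed

section \<open>Smooth boundary points\<close>

text \<open>Here \<open>g\<close> is the outward normal, so the points \<open>a - t g\<close> with
  \<open>t \<ge> 0\<close> run along the inner normal.\<close>

locale smooth_boundary_point =
  fixes D V :: "(complex ^ 'n) set" and a g :: "complex ^ 'n" and r :: "complex ^ 'n \<Rightarrow> real"
  assumes open_D: "open D" and open_V: "open V" and a_V: "a \<in> V" and smooth: "smooth_on V r"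
    and D_iff: "z \<in> V \<Longrightarrow> z \<in> D \<longleftrightarrow> r z < 0"
    and r_a: "r a = 0" and a_frontier: "a \<in> frontier D"
    and gradient: "GDERIV r a :> g" and g_nz: "g \<noteq> 0"
begin

lemma deriv_a: "frechet_derivative r (at a) v = v \<bullet> g"
  using frechet_derivative_at gradient unfolding gderiv_def by metis

lemma derivative_near:
  assumes "0 < e"
  shows "\<exists>d>0. ball a d \<subseteq> V \<and> (\<forall>y\<in>ball a d. \<bar>frechet_derivative r (at y) v - v \<bullet> g\<bar> \<le> e)"
proof -
  obtain d1 where d1: "d1 > 0" "ball a d1 \<subseteq> V"
    using open_V a_V open_contains_ball by blast
  have "isCont (\<lambda>y. frechet_derivative r (at y) v) a"
    using smooth_on_isCont[OF smooth_on_frechet_derivative[OF smooth] a_V] .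
  then obtain d2 where d2: "d2 > 0"
    "\<And>y. dist y a < d2 \<Longrightarrow> \<bar>frechet_derivative r (at y) v - v \<bullet> g\<bar> < e"
    using assms unfolding continuous_at_eps_delta dist_real_def deriv_a by meson
  show ?thesis
    using d1 d2 by (intro exI[of _ "min d1 d2"]) (force simp: dist_commute)
qed

lemma increment_le:
  assumes "ball a d \<subseteq> V" "\<And>y. y \<in> ball a d \<Longrightarrow> frechet_derivative r (at y) v \<in> {m..M}"
    and "y \<in> ball a d" "y + t *\<^sub>R v \<in> ball a d" "0 \<le> t"
  shows "r (y + t *\<^sub>R v) - r y \<in> {t * m..t * M}"
proof (cases "t = 0")
  case False
  have seg: "y + s *\<^sub>R v \<in> ball a d" if "0 \<le> s" "s \<le> t" for s
  proof -
    have "(1 - s / t) *\<^sub>R y + (s / t) *\<^sub>R (y + t *\<^sub>R v) \<in> ball a d"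
      using convexD_alt[OF convex_ball assms(3,4), of "s / t"] that False assms(5) by (simp add: divide_simps)
    also have "(1 - s / t) *\<^sub>R y + (s / t) *\<^sub>R (y + t *\<^sub>R v) = y + s *\<^sub>R v"
      using False by (simp add: algebra_simps)
    finally show ?thesis .
  qed
  have "r differentiable at (y + s *\<^sub>R v)" if "0 \<le> s" "s \<le> t" for s
    using smooth_on_differentiable[OF smooth] seg[OF that] assms(1) by blast
  then obtain s where "0 < s" "s < t" "r (y + t *\<^sub>R v) - r y = t * frechet_derivative r (at (y + s *\<^sub>R v)) v"
    using mvt_line[of t r y v] False assms(5) by auto
  then show ?thesis
    using assms(2)[OF seg[of s]] by (auto intro: mult_left_mono)
qed simp

text \<open>Near \<open>a\<close> the derivative of \<open>r\<close> along \<open>g\<close> is close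
  to \<open>g \<bullet> g\<close>, and along the tangential direction \<open>\<i> *s g\<close> it is
  close to 0. The mean value theorem turns both into increments; the tangential rate
  \<open>e\<close> can be prescribed arbitrarily small.\<close>

lemma normal_increments:
  assumes "0 < e"
  shows "\<exists>d>0. ball a d \<subseteq> V \<and> (\<forall>y\<in>ball a d.
    (\<forall>t\<ge>0. y + t *\<^sub>R g \<in> ball a d \<longrightarrow>
      t * ((g \<bullet> g) / 2) \<le> r (y + t *\<^sub>R g) - r y \<and> r (y + t *\<^sub>R g) - r y \<le> t * (2 * (g \<bullet> g))) \<and>
    (\<forall>t. y + t *\<^sub>R (\<i> *s g) \<in> ball a d \<longrightarrow> \<bar>r (y + t *\<^sub>R (\<i> *s g)) - r y\<bar> \<le> \<bar>t\<bar> * e))"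
proof -
  have G: "g \<bullet> g > 0"
    using g_nz by simp
  obtain d1 where d1: "d1 > 0" "ball a d1 \<subseteq> V"
    "\<And>y. y \<in> ball a d1 \<Longrightarrow> \<bar>frechet_derivative r (at y) g - g \<bullet> g\<bar> \<le> (g \<bullet> g) / 2"
    using derivative_near[of "(g \<bullet> g) / 2" g] G by auto
  obtain d2 where d2: "d2 > 0" "ball a d2 \<subseteq> V"
    "\<And>y. y \<in> ball a d2 \<Longrightarrow> \<bar>frechet_derivative r (at y) (\<i> *s g)\<bar> \<le> e"
    using derivative_near[of e "\<i> *s g"] assms unfolding inner_imaginary_smult by auto
  define d where "d = min d1 d2"
  have d: "d > 0" "ball a d \<subseteq> V"
    using d1 d2 unfolding d_def by auto
  have in12: "y \<in> ball a d1" "y \<in> ball a d2" if "y \<in> ball a d" for y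
    using that unfolding d_def by auto
  have bg: "frechet_derivative r (at y) g \<in> {(g \<bullet> g) / 2..2 * (g \<bullet> g)}" if "y \<in> ball a d" for y
    using d1(3)[OF in12(1)[OF that]] G unfolding abs_le_iff atLeastAtMost_iff by linarith
  have bi: "frechet_derivative r (at y) (\<i> *s g) \<in> {- e..e}" if "y \<in> ball a d" for y
    using d2(3)[OF in12(2)[OF that]] by auto
  have pos: "\<bar>r (y + t *\<^sub>R (\<i> *s g)) - r y\<bar> \<le> \<bar>t\<bar> * e"
    if "y \<in> ball a d" "y + t *\<^sub>R (\<i> *s g) \<in> ball a d" "0 \<le> t" for y t
    using increment_le[OF d(2) bi that] that(3) by auto
  have "\<bar>r (y + t *\<^sub>R (\<i> *s g)) - r y\<bar> \<le> \<bar>t\<bar> * e"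
    if "y \<in> ball a d" "y + t *\<^sub>R (\<i> *s g) \<in> ball a d" for y t
  proof (cases "0 \<le> t")
    case False
    then have "\<bar>r y - r (y + t *\<^sub>R (\<i> *s g))\<bar> \<le> \<bar>- t\<bar> * e"
      using pos[of "y + t *\<^sub>R (\<i> *s g)" "- t"] that by simp
    then show ?thesis
      by (simp add: abs_minus_commute)
  qed (use pos that in blast)
  then show ?thesis
    using d increment_le[OF d(2) bg] by (intro exI[of _ d]) auto
qed

text \<open>The upper bound is the distance to \<open>a\<close> itself. For the lower bound a ball
  of radius \<open>n / 4 * t\<close> fits into \<open>D\<close>: on it the linear part of
  \<open>r\<close> is at most \<open>- 3 / 4 * n * n * t\<close>, and the first-order error at most
  \<open>5 / 16 * n * n * t\<close>.\<close>

lemma boundary_dist_inner_normal: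
  "\<exists>d>0. \<forall>t. 0 < t \<and> t < d \<longrightarrow>
    norm g / 4 * t \<le> boundary_dist D (a - t *\<^sub>R g) \<and> boundary_dist D (a - t *\<^sub>R g) \<le> norm g * t"
proof -
  define n where "n = norm g"
  have n: "n > 0"
    using g_nz unfolding n_def by simp
  obtain d1 where d1: "d1 > 0" "ball a d1 \<subseteq> V"
    using open_V a_V open_contains_ball by blast
  have "(r has_derivative (\<lambda>h. h \<bullet> g)) (at a)"
    using gradient unfolding gderiv_def .
  then obtain d2 where d2: "d2 > 0"
    "\<And>y. norm (y - a) < d2 \<Longrightarrow> norm (r y - r a - (y - a) \<bullet> g) \<le> n / 4 * norm (y - a)"
    unfolding has_derivative_at_alt using n by (meson divide_pos_pos zero_less_numeral)
  define d where "d = min d1 d2 / (2 * n)"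
  have "d > 0"
    unfolding d_def using d1 d2 n by simp
  have "n / 4 * t \<le> boundary_dist D (a - t *\<^sub>R g)" if t: "0 < t" "t < d" for t
  proof -
    have inD: "y \<in> D" if "dist (a - t *\<^sub>R g) y < n / 4 * t" for y
    proof -
      define v where "v = y - (a - t *\<^sub>R g)"
      have v: "norm v < n / 4 * t" "y - a = v - t *\<^sub>R g"
        using that unfolding v_def by (auto simp: dist_norm norm_minus_commute)
      have "norm (y - a) \<le> norm v + t * n"
        unfolding v(2) using norm_triangle_ineq4[of v "t *\<^sub>R g"] t by (simp add: n_def)
      then have y1: "norm (y - a) < 5 / 4 * (n * t)"
        using v(1) by (simp add: algebra_simps)
      have "2 * (n * t) < min d1 d2"
        using t n unfolding d_def by (simp add: field_simps)
      moreover have "0 < n * t"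
        using n t by simp
      ultimately have y2: "norm (y - a) < d1" "norm (y - a) < d2"
        using y1 by auto
      have "v \<bullet> g \<le> norm v * n"
        unfolding n_def by (rule norm_cauchy_schwarz)
      also have "\<dots> \<le> (n / 4 * t) * n"
        using v(1) n by (intro mult_right_mono) auto
      finally have "(y - a) \<bullet> g \<le> - (3 / 4) * (n * n * t)"
        unfolding v(2) by (simp add: inner_diff_left n_def power2_norm_eq_inner[symmetric] power2_eq_square algebra_simps)
      moreover have "r y \<le> (y - a) \<bullet> g + n / 4 * norm (y - a)"
        using d2(2)[OF y2(2)] r_a unfolding real_norm_def abs_le_iff by linarith
      moreover have "n / 4 * norm (y - a) \<le> n / 4 * (5 / 4 * (n * t))"
        using y1 n by (intro mult_left_mono) auto
      moreover have "0 < n * n * t"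
        using n t by simp
      ultimately have "r y < 0"
        by (simp add: algebra_simps)
      moreover have "y \<in> V"
        using y2(1) d1(2) by (auto simp: dist_norm norm_minus_commute subset_iff)
      ultimately show ?thesis
        using D_iff by blast
    qed
    have "frontier D \<noteq> {}"
      using a_frontier by blast
    moreover have "n / 4 * t \<le> dist (a - t *\<^sub>R g) y" if "y \<in> frontier D" for y
      using inD[of y] that open_D by (force simp: frontier_def interior_open)
    ultimately show ?thesis
      unfolding boundary_dist_def infdist_def by (simp only: if_False) (intro cINF_greatest)
  qed
  moreover have "boundary_dist D (a - t *\<^sub>R g) \<le> n * t" if "0 < t" for t
    using infdist_le[OF a_frontier, of "a - t *\<^sub>R g"] that
    unfolding boundary_dist_def n_def by (simp add: dist_norm mult.commute)
  ultimately show ?thesis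
    using \<open>d > 0\<close> unfolding n_def by blast
qed

section \<open>Discs in direction \<open>X\<close> centred on the inner normal\<close>

text \<open>The inward shift by \<open>t g\<close> lowers \<open>r\<close> by at least
  \<open>t * (G / 2)\<close>, which outweighs \<open>C * cmod \<zeta> ^ l\<close> as long as
  \<open>cmod \<zeta> ^ l\<close> is below a small multiple of \<open>t\<close>.\<close>

lemma disc_in_domain:
  assumes "0 < l" "0 \<le> C" "0 < d"
    and upper: "\<And>\<zeta>. cmod \<zeta> < d \<Longrightarrow> r (a + \<zeta> *s X) \<le> C * cmod \<zeta> ^ l"
  shows "\<exists>c>0. \<exists>e>0. \<forall>t. 0 < t \<and> t < e \<longrightarrow>
    (\<exists>\<rho>>0. \<rho> ^ l = c * t \<and> (\<forall>\<zeta>. cmod \<zeta> < \<rho> \<longrightarrow> a - t *\<^sub>R g + \<zeta> *s X \<in> D))"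
proof -
  define G where "G = g \<bullet> g"
  have "G > 0"
    unfolding G_def using g_nz by simp
  obtain d1 where d1: "d1 > 0" "ball a d1 \<subseteq> V"
    "\<And>y t. \<lbrakk>y \<in> ball a d1; 0 \<le> t; y + t *\<^sub>R g \<in> ball a d1\<rbrakk> \<Longrightarrow> t * (G / 2) \<le> r (y + t *\<^sub>R g) - r y"
    using normal_increments[of 1] unfolding G_def by (metis zero_less_one)
  \<comment> \<open>With this \<open>c\<close> the bound \<open>C * \<rho> ^ l = C * c * t\<close>
    is at most \<open>t * (G / 4)\<close>, half of the gain; \<open>C + 1\<close> covers
    \<open>C = 0\<close>.\<close>
  define c where "c = G / (4 * (C + 1))"
  define s where "s = min d (d1 / (2 * (norm X + 1)))"
  define e where "e = min (d1 / (2 * norm g)) (s ^ l / c)"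
  have "c > 0" "s > 0"
    unfolding c_def s_def using \<open>G > 0\<close> assms(2,3) d1(1) by (auto intro!: divide_pos_pos add_nonneg_pos)
  then have "e > 0"
    unfolding e_def using d1(1) g_nz by simp
  have "\<exists>\<rho>>0. \<rho> ^ l = c * t \<and> (\<forall>\<zeta>. cmod \<zeta> < \<rho> \<longrightarrow> a - t *\<^sub>R g + \<zeta> *s X \<in> D)" if t: "0 < t" "t < e" for t
  proof (intro exI conjI allI impI)
    define \<rho> where "\<rho> = root l (c * t)"
    show "root l (c * t) > 0" "root l (c * t) ^ l = c * t"
      using t \<open>c > 0\<close> assms(1) by simp_all
    have \<rho>: "\<rho> > 0" "\<rho> ^ l = c * t"
      unfolding \<rho>_def using t \<open>c > 0\<close> assms(1) by simp_all
    have "\<rho> ^ l < s ^ l"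
      unfolding \<rho>(2) using t \<open>c > 0\<close> unfolding e_def by (simp add: field_simps)
    then have "\<rho> < s"
      using \<open>s > 0\<close> power_less_imp_less_base by (metis less_imp_le)
    fix \<zeta> assume "cmod \<zeta> < root l (c * t)"
    then have \<zeta>: "cmod \<zeta> < \<rho>"
      unfolding \<rho>_def .
    define y where "y = a - t *\<^sub>R g + \<zeta> *s X"
    have "cmod \<zeta> * norm X \<le> d1 / (2 * (norm X + 1)) * norm X"
      using \<zeta> \<open>\<rho> < s\<close> unfolding s_def by (intro mult_right_mono) auto
    also have "\<dots> < d1 / 2"
      using d1(1) by (simp add: divide_simps add_nonneg_pos)
    finally have X: "norm (\<zeta> *s X) < d1 / 2"
      by (simp add: norm_vector_smult)
    have g: "norm (t *\<^sub>R g) < d1 / 2"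
      using t g_nz unfolding e_def by (simp add: field_simps)
    have "norm (\<zeta> *s X - t *\<^sub>R g) < d1"
      using norm_triangle_ineq4[of "\<zeta> *s X" "t *\<^sub>R g"] X g by linarith
    then have y: "y \<in> ball a d1"
      unfolding y_def by (simp add: dist_norm algebra_simps norm_minus_commute)
    have "y + t *\<^sub>R g = a + \<zeta> *s X"
      unfolding y_def by simp
    moreover have "a + \<zeta> *s X \<in> ball a d1"
      using X d1(1) by (simp add: dist_norm)
    ultimately have "t * (G / 2) \<le> r (a + \<zeta> *s X) - r y"
      using d1(3)[OF y, of t] t by simp
    moreover have "r (a + \<zeta> *s X) \<le> C * cmod \<zeta> ^ l"
      using upper \<zeta> \<open>\<rho> < s\<close> unfolding s_def by simp
    moreover have "C * cmod \<zeta> ^ l \<le> C * \<rho> ^ l"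
      using \<zeta> assms(2) by (intro mult_left_mono power_mono) auto
    moreover have "C * \<rho> ^ l \<le> t * (G / 4)"
      unfolding \<rho>(2) c_def using \<open>G > 0\<close> t assms(2) by (simp add: field_simps)
    ultimately have "r y \<le> t * (G / 4) - t * (G / 2)"
      by linarith
    also have "\<dots> < 0"
      using \<open>G > 0\<close> t by simp
    finally show "a - t *\<^sub>R g + \<zeta> *s X \<in> D"
      using D_iff y d1(2) unfolding y_def by blast
  qed
  then show ?thesis
    using \<open>c > 0\<close> \<open>e > 0\<close> by blast
qed

text \<open>The inward shift lowers \<open>r\<close> by at most \<open>t * (2 * G)\<close>, so a
  point of the disc in direction \<open>w\<close> at parameter \<open>s\<close> can lie in
  \<open>D\<close> only if \<open>c * s ^ l < t * (2 * G)\<close>.\<close>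

lemma disc_radius_bound:
  assumes "0 < l" "0 < c" "0 < d"
    and lower: "\<And>s. \<lbrakk>0 \<le> s; s < d\<rbrakk> \<Longrightarrow> c * s ^ l \<le> r (a + (of_real s * w) *s X)"
  shows "\<exists>C>0. \<exists>e>0. \<forall>t \<rho>. 0 < t \<and> t < e \<and> 0 < \<rho> \<and>
    (\<forall>\<zeta>. cmod \<zeta> < \<rho> \<longrightarrow> a - t *\<^sub>R g + \<zeta> *s X \<in> D) \<longrightarrow> \<rho> ^ l \<le> C * t"
proof -
  define G where "G = g \<bullet> g"
  have "G > 0"
    unfolding G_def using g_nz by simp
  have w: "cmod w > 0"
  proof (rule ccontr)
    assume "\<not> 0 < cmod w"
    then have "c * (d / 2) ^ l \<le> 0"
      using lower[of "d / 2"] r_a assms(3) by simp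
    moreover have "0 < c * (d / 2) ^ l"
      using assms(2,3) by (intro mult_pos_pos zero_less_power) auto
    ultimately show False
      by linarith
  qed
  obtain d1 where d1: "d1 > 0" "ball a d1 \<subseteq> V"
    "\<And>y t. \<lbrakk>y \<in> ball a d1; 0 \<le> t; y + t *\<^sub>R g \<in> ball a d1\<rbrakk> \<Longrightarrow> r (y + t *\<^sub>R g) - r y \<le> t * (2 * G)"
    using normal_increments[of 1] unfolding G_def by (metis zero_less_one)
  define B where "B = cmod w * norm X + 1"
  have "B > 0"
    unfolding B_def by (simp add: add_nonneg_pos)
  define s1 where "s1 = min (d / 2) (d1 / (2 * B))"
  have "s1 > 0"
    unfolding s1_def using assms(3) d1(1) \<open>B > 0\<close> by simp
  define e where "e = min (d1 / (2 * norm g)) (c * s1 ^ l / (2 * G))"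
  have "e > 0"
    unfolding e_def using d1(1) g_nz \<open>s1 > 0\<close> assms(2) \<open>G > 0\<close> by simp
  define C where "C = (2 * cmod w) ^ l * (2 * G / c)"
  have "C > 0"
    unfolding C_def using w \<open>G > 0\<close> assms(2) by simp
  have "\<rho> ^ l \<le> C * t" if t: "0 < t" "t < e" and \<rho>: "0 < \<rho>"
    and disc: "\<And>\<zeta>. cmod \<zeta> < \<rho> \<Longrightarrow> a - t *\<^sub>R g + \<zeta> *s X \<in> D" for t \<rho>
  proof -
    \<comment> \<open>The test point lies at half the radius in direction \<open>w\<close>; the cap
      \<open>s1\<close> keeps it near \<open>a\<close> when \<open>\<rho>\<close> is large, and the
      choice of \<open>e\<close> later shows that the cap is not attained.\<close>
    define s where "s = min (\<rho> / (2 * cmod w)) s1"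
    have s: "0 < s" "s \<le> s1" "s < d"
      unfolding s_def using \<rho> w \<open>s1 > 0\<close> assms(3) by (auto simp: s1_def)
    define \<zeta> where "\<zeta> = of_real s * w"
    have "cmod \<zeta> = s * cmod w"
      unfolding \<zeta>_def using s by (simp add: norm_mult)
    also have "\<dots> \<le> \<rho> / (2 * cmod w) * cmod w"
      using w unfolding s_def by (intro mult_right_mono) auto
    also have "\<dots> < \<rho>"
      using \<rho> w by simp
    finally have inD: "a - t *\<^sub>R g + \<zeta> *s X \<in> D"
      by (rule disc)
    have "norm (\<zeta> *s X) = s * (cmod w * norm X)"
      unfolding \<zeta>_def using s by (simp add: norm_vector_smult norm_mult)
    also have "\<dots> < s * B"
      using s(1) unfolding B_def by simp
    also have "\<dots> \<le> d1 / (2 * B) * B"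
      using s \<open>B > 0\<close> unfolding s1_def by (intro mult_right_mono) auto
    also have "\<dots> = d1 / 2"
      using \<open>B > 0\<close> by simp
    finally have X: "norm (\<zeta> *s X) < d1 / 2" .
    have g: "norm (t *\<^sub>R g) < d1 / 2"
      using t g_nz unfolding e_def by (simp add: field_simps)
    define y where "y = a - t *\<^sub>R g + \<zeta> *s X"
    have "norm (\<zeta> *s X - t *\<^sub>R g) < d1"
      using norm_triangle_ineq4[of "\<zeta> *s X" "t *\<^sub>R g"] X g by linarith
    then have y: "y \<in> ball a d1"
      unfolding y_def by (simp add: dist_norm algebra_simps norm_minus_commute)
    have "y + t *\<^sub>R g = a + \<zeta> *s X"
      unfolding y_def by simp
    moreover have "a + \<zeta> *s X \<in> ball a d1"
      using X d1(1) by (simp add: dist_norm)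
    ultimately have "r (a + \<zeta> *s X) - r y \<le> t * (2 * G)"
      using d1(3)[OF y, of t] t by simp
    moreover have "r y < 0"
      using inD D_iff y d1(2) unfolding y_def by blast
    moreover have "c * s ^ l \<le> r (a + \<zeta> *s X)"
      using lower s unfolding \<zeta>_def by simp
    ultimately have cs: "c * s ^ l < t * (2 * G)"
      by linarith
    have "t * (2 * G) < c * s1 ^ l"
      using t \<open>G > 0\<close> unfolding e_def by (simp add: field_simps)
    then have "s \<noteq> s1"
      using cs by auto
    then have "\<rho> = 2 * cmod w * s"
      using w unfolding s_def by (auto simp: min_def split: if_splits)
    then have "\<rho> ^ l = (2 * cmod w) ^ l * s ^ l"
      by (simp add: power_mult_distrib)
    also have "\<dots> \<le> (2 * cmod w) ^ l * (t * (2 * G) / c)"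
      using cs assms(2) by (intro mult_left_mono) (auto simp: field_simps)
    also have "\<dots> = C * t"
      unfolding C_def by simp
    finally show ?thesis .
  qed
  then show ?thesis
    using \<open>C > 0\<close> \<open>e > 0\<close> by blast
qed


text \<open>
  If \<open>r (a + s Y)\<close> were at most \<open>- c \<bar>s\<bar>\<^sup>l\<close> for small real \<open>s\<close> of both signs, a path \<open>\<gamma>\<close> in
  \<open>D\<close> on the line through \<open>a\<close> would join \<open>s0\<close> to \<open>- s0\<close>. We close it by the segment
  \<open>[- s0, s0]\<close> and view it in the tilted lines \<open>a - t g + \<zeta> (Y - \<i> \<sigma> \<epsilon> g)\<close> with \<open>\<epsilon> = h\<^sup>l\<^sup>-\<^sup>1\<close>
  and \<open>t = \<tau> h\<^sup>l\<close>. All terms are then of order \<open>h\<^sup>l\<close>: on the segment the tilt only moves in the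
  tangential direction \<open>\<i> g\<close>, which costs little, so the inward shift \<open>t\<close> keeps it in \<open>D\<close>; at
  \<open>\<zeta> = \<i> \<sigma> k h\<close> the tilt moves outward by \<open>k h\<^sup>l\<close>, which beats \<open>t\<close> and leaves \<open>D\<close>. By simple
  connectedness the closed curve has winding number \<open>0\<close> about both points \<open>\<plusminus>\<i> k h\<close>, although it
  crosses between them exactly once.
\<close>

lemma C_convex_not_negative_tangentially:
  assumes "C_convex_domain D" "2 \<le> l" "0 < c" "0 \<le> C" "0 < d"
    and neg: "\<And>s::real. \<bar>s\<bar> < d \<Longrightarrow> r (a + of_real s *s Y) \<le> - c * \<bar>s\<bar> ^ l"
    and bound: "\<And>\<zeta>. cmod \<zeta> < d \<Longrightarrow> \<bar>r (a + \<zeta> *s Y)\<bar> \<le> C * cmod \<zeta> ^ l"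
  shows False
proof -
  define G where "G = g \<bullet> g"
  have "G > 0"
    unfolding G_def using g_nz by simp
  have "Y \<noteq> 0"
  proof
    assume "Y = 0"
    then have "c * (d / 2) ^ l \<le> 0"
      using neg[of "d / 2"] r_a assms(5) by simp
    moreover have "0 < c * (d / 2) ^ l"
      using assms(3,5) by (intro mult_pos_pos zero_less_power) auto
    ultimately show False
      by linarith
  qed
  \<comment> \<open>Since \<open>2 \<le> l\<close>, the function at distance \<open>k * h\<close> on
    the untilted line is at most \<open>C * k * (k * h ^ l)\<close>. Making \<open>C * k\<close>
    small against \<open>G\<close> lets the outward displacement \<open>k * h ^ l\<close>
    win.\<close>
  define k where "k = min (1 / 2) (G / (8 * (C + 1)))"
  have k: "0 < k" "k \<le> 1 / 2" "C * k \<le> G / 8"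
  proof -
    show "0 < k"
      unfolding k_def using \<open>G > 0\<close> assms(4) by simp
    show "k \<le> 1 / 2"
      unfolding k_def by (rule min.cobounded1)
    have "k \<le> G / (8 * (C + 1))"
      unfolding k_def by (rule min.cobounded2)
    then have "C * k \<le> (C + 1) * (G / (8 * (C + 1)))"
      using \<open>G > 0\<close> assms(4) \<open>0 < k\<close> by (intro mult_mono) auto
    moreover have "x * (G / (8 * x)) = G / 8" if "0 < x" for x :: real
      using that by simp
    from this[of "C + 1"] have "(C + 1) * (G / (8 * (C + 1))) = G / 8"
      using assms(4) by linarith
    ultimately show "C * k \<le> G / 8"
      by linarith
  qed
  define \<eta> where "\<eta> = min c (k * G / 16)"
  define \<tau> where "\<tau> = 4 * \<eta> / G"
  have "0 < \<eta>"
    unfolding \<eta>_def using assms(3) k(1) \<open>G > 0\<close> by simp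
  moreover have "\<eta> \<le> c" "\<eta> \<le> k * G / 16"
    unfolding \<eta>_def by (blast intro: min.cobounded1 min.cobounded2)+
  ultimately have \<eta>: "0 < \<eta>" "\<eta> \<le> c" "\<eta> \<le> k * G / 16"
    by auto
  have \<tau>: "0 < \<tau>" "\<tau> \<le> k / 4" "\<tau> * (G / 2) = 2 * \<eta>"
    unfolding \<tau>_def using \<eta> \<open>G > 0\<close> by (auto simp: field_simps)
  obtain \<delta> where \<delta>: "\<delta> > 0" "ball a \<delta> \<subseteq> V"
    "\<And>y t. \<lbrakk>y \<in> ball a \<delta>; 0 \<le> t; y + t *\<^sub>R g \<in> ball a \<delta>\<rbrakk> \<Longrightarrow> t * (G / 2) \<le> r (y + t *\<^sub>R g) - r y"
    "\<And>y t. \<lbrakk>y \<in> ball a \<delta>; y + t *\<^sub>R (\<i> *s g) \<in> ball a \<delta>\<rbrakk> \<Longrightarrow> \<bar>r (y + t *\<^sub>R (\<i> *s g)) - r y\<bar> \<le> \<bar>t\<bar> * \<eta>"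
    using normal_increments[OF \<eta>(1)] unfolding G_def by blast
  define s0 where "s0 = min (d / 2) (\<delta> / (4 * norm Y))"
  have s0: "0 < s0" "s0 < d" "s0 * norm Y < \<delta> / 2"
  proof -
    show "0 < s0"
      unfolding s0_def using assms(5) \<delta>(1) \<open>Y \<noteq> 0\<close> by simp
    have *: "s0 \<le> d / 2" "s0 \<le> \<delta> / (4 * norm Y)"
      unfolding s0_def by (blast intro: min.cobounded1 min.cobounded2)+
    then show "s0 < d"
      using assms(5) by linarith
    have "s0 * norm Y \<le> \<delta> / (4 * norm Y) * norm Y"
      using *(2) by (intro mult_right_mono) auto
    then show "s0 * norm Y < \<delta> / 2"
      using \<delta>(1) \<open>Y \<noteq> 0\<close> by simp
  qed
  have ball_Y: "a + \<zeta> *s Y \<in> ball a (\<delta> / 2)" if "cmod \<zeta> \<le> s0" for \<zeta>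
  proof -
    have "cmod \<zeta> * norm Y \<le> s0 * norm Y"
      using that by (intro mult_right_mono) auto
    then show ?thesis
      using s0(3) by (simp add: dist_norm norm_vector_smult)
  qed

  define D0 where "D0 = {\<zeta>. a + \<zeta> *s Y \<in> D}"
  have ends: "of_real s0 \<in> D0" "- of_real s0 \<in> D0"
  proof -
    have "of_real s \<in> D0" if s: "\<bar>s\<bar> = s0" for s
    proof -
      have "0 < c * s0 ^ l"
        using assms(3) s0(1) by simp
      then have "r (a + of_real s *s Y) < 0"
        using neg[of s] s s0(2) by simp
      moreover have "a + of_real s *s Y \<in> V"
        using ball_Y[of "of_real s"] s \<delta>(1,2) by auto
      ultimately show ?thesis
        unfolding D0_def using D_iff by blast
    qed
    from this[of s0] this[of "- s0"] show "of_real s0 \<in> D0" "- of_real s0 \<in> D0"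
      using s0(1) by auto
  qed
  have "simply_connected D0"
    unfolding D0_def
    by (rule simply_connected_line_parameters[OF assms(1) \<open>Y \<noteq> 0\<close>, of _ "of_real s0"])
       (use ends(1) in \<open>simp add: D0_def\<close>)
  then have "path_connected D0"
    by (rule simply_connected_imp_path_connected)
  then obtain \<gamma> where \<gamma>: "path \<gamma>" "path_image \<gamma> \<subseteq> D0" "pathstart \<gamma> = of_real s0" "pathfinish \<gamma> = - of_real s0"
    using ends unfolding path_connected_def by blast
  have cK: "compact (path_image \<gamma>)"
    using \<gamma>(1) by (rule compact_path_image)
  have "a \<notin> D"
    using D_iff a_V r_a by simp
  then have "0 \<notin> path_image \<gamma>"
    using \<gamma>(2) unfolding D0_def by auto
  then have "0 \<in> - path_image \<gamma>" "open (- path_image \<gamma>)"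
    using compact_imp_closed[OF cK] by auto
  then obtain m where m: "m > 0" "ball 0 m \<subseteq> - path_image \<gamma>"
    using open_contains_ball by blast
  obtain M where M: "M > 0" "\<And>\<zeta>. \<zeta> \<in> path_image \<gamma> \<Longrightarrow> cmod \<zeta> \<le> M"
    using compact_imp_bounded[OF cK] unfolding bounded_pos by blast
  have "compact ((\<lambda>\<zeta>. a + \<zeta> *s Y) ` path_image \<gamma>)"
    by (intro compact_continuous_image cK continuous_on_add continuous_on_const
        linear_continuous_on bounded_linear_vector_smult)
  moreover have "(\<lambda>\<zeta>. a + \<zeta> *s Y) ` path_image \<gamma> \<subseteq> D"
    using \<gamma>(2) unfolding D0_def by auto
  ultimately obtain \<rho> where \<rho>: "\<rho> > 0" "(\<Union>x\<in>(\<lambda>\<zeta>. a + \<zeta> *s Y) ` path_image \<gamma>. ball x \<rho>) \<subseteq> D"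
    using compact_subset_open_imp_ball_epsilon_subset[OF _ open_D] by metis

  define B where "B = (M + s0 + 1) * norm g"
  have B: "B > 0" "norm g \<le> B" "(M + 1) * norm g \<le> B" "(s0 + 1) * norm g \<le> B"
  proof -
    show "B > 0"
      unfolding B_def using M(1) s0(1) g_nz by (intro mult_pos_pos) auto
    have "1 * norm g \<le> B"
      unfolding B_def using M(1) s0(1) by (intro mult_right_mono) auto
    then show "norm g \<le> B"
      by simp
    show "(M + 1) * norm g \<le> B" "(s0 + 1) * norm g \<le> B"
      unfolding B_def using M(1) s0(1) by (intro mult_right_mono; simp)+
  qed
  \<comment> \<open>Chosen after the curve is fixed: \<open>h < m\<close> places the two test points
    nearer to 0 than the curve, \<open>h * B < \<rho>\<close> keeps the displaced curve in
    \<open>D\<close>, \<open>h * B < \<delta> / 2\<close> keeps the segment where increments are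
    controlled, and \<open>h * B < norm Y\<close> makes the tilted direction nonzero.\<close>
  define h where "h = min (min (1 / 2) (min (m / 2) (s0 / 2)))
    (min (\<rho> / (2 * B)) (min (\<delta> / (4 * B)) (norm Y / (2 * B))))"
  have h0: "0 < h"
    unfolding h_def using m s0 \<rho> \<delta>(1) \<open>Y \<noteq> 0\<close> B(1) by simp
  have "h \<le> 1 / 2" "h \<le> m / 2" "h \<le> s0 / 2"
    unfolding h_def by (blast intro: min.coboundedI1 min.coboundedI2 order_refl)+
  then have h: "h < 1" "h < m" "h < s0"
    using m(1) s0(1) by linarith+
  have hB: "h * B < \<rho>" "h * B < \<delta> / 2" "h * B < norm Y"
  proof -
    have "h \<le> \<rho> / (2 * B)" "h \<le> \<delta> / (4 * B)" "h \<le> norm Y / (2 * B)"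
      unfolding h_def by (blast intro: min.coboundedI1 min.coboundedI2 order_refl)+
    then have "h * B \<le> \<rho> / 2" "h * B \<le> \<delta> / 4" "h * B \<le> norm Y / 2"
      using B(1) by (auto simp: field_simps)
    then show "h * B < \<rho>" "h * B < \<delta> / 2" "h * B < norm Y"
      using \<rho>(1) \<delta>(1) zero_less_norm_iff[THEN iffD2, OF \<open>Y \<noteq> 0\<close>] by linarith+
  qed
  define \<epsilon> where "\<epsilon> = h ^ (l - 1)"
  define t where "t = \<tau> * h ^ l"
  have hl: "h ^ l = \<epsilon> * h"
    unfolding \<epsilon>_def using assms(2) by (cases l) auto
  have \<epsilon>: "0 < \<epsilon>" "\<epsilon> \<le> h"
    unfolding \<epsilon>_def using h0 h(1) assms(2) power_decreasing[of 1 "l - 1" h] by auto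
  have "\<epsilon> * h \<le> h * 1"
    using \<epsilon> h h0 by (intro mult_mono) auto
  then have "\<tau> * (\<epsilon> * h) \<le> 1 * h"
    using \<tau> k \<epsilon> h0 by (intro mult_mono) auto
  then have t: "0 < t" "t \<le> h"
    unfolding t_def hl using \<tau> \<epsilon> h0 by auto

  have winding: "winding_number (\<gamma> +++ linepath (- of_real s0) (of_real s0)) (\<i> * of_real (\<sigma> * (k * h))) = 0"
    if \<sigma>: "\<sigma> = 1 \<or> \<sigma> = - 1" for \<sigma> :: real
  proof -
    define u where "u = of_real (- \<sigma> * \<epsilon>) * \<i>"
    define p where "p = a - t *\<^sub>R g"
    define v where "v = Y + u *s g"
    define \<Omega> where "\<Omega> = {\<zeta>. p + \<zeta> *s v \<in> D}"
    have pv: "p + \<zeta> *s v = a + \<zeta> *s Y + ((\<zeta> * u) *s g - t *\<^sub>R g)" for \<zeta>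
      unfolding p_def v_def by (simp add: vec_eq_iff algebra_simps)
    have u: "cmod u = \<epsilon>"
      unfolding u_def using \<sigma> \<epsilon> by (auto simp: norm_mult)
    have pert: "norm ((\<zeta> * u) *s g - t *\<^sub>R g) \<le> h * ((K + 1) * norm g)" if "cmod \<zeta> \<le> K" for \<zeta> K
    proof -
      have "norm ((\<zeta> * u) *s g - t *\<^sub>R g) \<le> cmod \<zeta> * \<epsilon> * norm g + t * norm g"
        using norm_triangle_ineq4[of "(\<zeta> * u) *s g" "t *\<^sub>R g"] t(1) u
        by (simp add: norm_vector_smult norm_mult)
      also have "\<dots> \<le> K * h * norm g + h * norm g"
        using that \<epsilon> t h0 by (intro add_mono mult_right_mono mult_mono) (auto intro: order_trans[OF norm_ge_zero])
      finally show ?thesis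
        by (simp add: algebra_simps)
    qed
    have "v \<noteq> 0"
    proof
      assume "v = 0"
      then have "norm Y = norm (u *s g)"
        unfolding v_def by (metis eq_neg_iff_add_eq_0 norm_minus_cancel)
      also have "\<dots> \<le> h * B"
        using u \<epsilon> B(2) h0 mult_mono[of "cmod u" h "norm g" B] by (simp add: norm_vector_smult)
      finally show False
        using hB(3) by linarith
    qed
    have \<gamma>_in: "path_image \<gamma> \<subseteq> \<Omega>"
    proof
      fix \<zeta> assume \<zeta>: "\<zeta> \<in> path_image \<gamma>"
      have "norm ((\<zeta> * u) *s g - t *\<^sub>R g) \<le> h * B"
        by (rule order_trans[OF pert[OF M(2)[OF \<zeta>]] mult_left_mono[OF B(3) less_imp_le[OF h0]]])
      then have "p + \<zeta> *s v \<in> ball (a + \<zeta> *s Y) \<rho>"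
        unfolding pv using hB(1) by (simp add: dist_norm norm_minus_commute)
      then show "\<zeta> \<in> \<Omega>"
        unfolding \<Omega>_def using \<rho>(2) \<zeta> by blast
    qed
    have near: "p + \<zeta> *s v \<in> ball a \<delta>" "a + \<zeta> *s Y + (\<zeta> * u) *s g \<in> ball a \<delta>" "a + \<zeta> *s Y \<in> ball a \<delta>"
      if "cmod \<zeta> \<le> s0" for \<zeta>
    proof -
      have Y: "norm (\<zeta> *s Y) < \<delta> / 2"
        using ball_Y[OF that] by (simp add: dist_norm)
      have 1: "norm ((\<zeta> * u) *s g - t *\<^sub>R g) \<le> h * B"
        by (rule order_trans[OF pert[OF that] mult_left_mono[OF B(4) less_imp_le[OF h0]]])
      have "cmod \<zeta> * \<epsilon> * norm g \<le> s0 * h * norm g"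
        using that \<epsilon> s0(1) by (intro mult_right_mono mult_mono) auto
      also have "\<dots> \<le> h * ((s0 + 1) * norm g)"
        using h0 by (simp add: algebra_simps)
      also have "\<dots> \<le> h * B"
        using B(4) h0 by (intro mult_left_mono) auto
      finally have 2: "norm ((\<zeta> * u) *s g) \<le> h * B"
        by (simp add: norm_vector_smult norm_mult u)
      have "a + \<zeta> *s Y + w \<in> ball a \<delta>" if "norm w \<le> h * B" for w
      proof -
        have "norm (\<zeta> *s Y + w) < \<delta>"
          using norm_triangle_ineq[of "\<zeta> *s Y" w] Y that hB(2) by linarith
        moreover have "dist a (a + \<zeta> *s Y + w) = norm (\<zeta> *s Y + w)"
          by (metis add.assoc add_diff_cancel_left' dist_commute dist_norm)
        ultimately show ?thesis
          by simp
      qed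
      from this[OF 1] this[OF 2] this[of 0] show "p + \<zeta> *s v \<in> ball a \<delta>"
        "a + \<zeta> *s Y + (\<zeta> * u) *s g \<in> ball a \<delta>" "a + \<zeta> *s Y \<in> ball a \<delta>"
        unfolding pv using h0 B(1) by auto
    qed
    have seg_in: "closed_segment (- of_real s0) (of_real s0) \<subseteq> \<Omega>"
    proof
      fix \<zeta> :: complex assume "\<zeta> \<in> closed_segment (- of_real s0) (of_real s0)"
      then obtain q where q: "0 \<le> q" "q \<le> 1" "\<zeta> = (1 - q) *\<^sub>R (- of_real s0) + q *\<^sub>R of_real s0"
        unfolding closed_segment_def by auto
      define x where "x = (2 * q - 1) * s0"
      have \<zeta>: "\<zeta> = of_real x"
        unfolding q(3) x_def by (simp add: scaleR_conv_of_real algebra_simps)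
      have "\<bar>2 * q - 1\<bar> * s0 \<le> 1 * s0"
        using q s0(1) by (intro mult_right_mono) auto
      then have x: "\<bar>x\<bar> \<le> s0"
        unfolding x_def using s0(1) by (simp add: abs_mult)
      then have cx: "cmod \<zeta> \<le> s0"
        unfolding \<zeta> by simp
      define y0 where "y0 = a + \<zeta> *s Y"
      \<comment> \<open>For real \<open>\<zeta>\<close> the tilt is a real multiple of
        \<open>\<i> *s g\<close>, hence purely tangential.\<close>
      have ug: "(\<zeta> * u) *s g = (- \<sigma> * \<epsilon> * x) *\<^sub>R (\<i> *s g)"
        unfolding u_def \<zeta> by (simp add: vec_eq_iff) (simp add: scaleR_conv_of_real algebra_simps)
      have "\<bar>r (y0 + (\<zeta> * u) *s g) - r y0\<bar> \<le> \<bar>- \<sigma> * \<epsilon> * x\<bar> * \<eta>"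
        using \<delta>(4)[of y0 "- \<sigma> * \<epsilon> * x"] near[OF cx] unfolding ug y0_def by blast
      also have "\<dots> = \<epsilon> * \<bar>x\<bar> * \<eta>"
        using \<sigma> \<epsilon> by (auto simp: abs_mult)
      finally have 1: "r (y0 + (\<zeta> * u) *s g) \<le> r y0 + \<epsilon> * \<bar>x\<bar> * \<eta>"
        by linarith
      have "p + \<zeta> *s v + t *\<^sub>R g = y0 + (\<zeta> * u) *s g"
        unfolding pv y0_def by simp
      then have "t * (G / 2) \<le> r (y0 + (\<zeta> * u) *s g) - r (p + \<zeta> *s v)"
        using \<delta>(3)[of "p + \<zeta> *s v" t] near[OF cx] t(1) unfolding y0_def by simp
      moreover have "t * (G / 2) = 2 * \<eta> * (\<epsilon> * h)"
        unfolding t_def hl \<tau>(3)[symmetric] by simp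
      moreover have "r y0 \<le> - c * \<bar>x\<bar> ^ l"
        unfolding y0_def \<zeta> using neg x s0(2) by simp
      ultimately have r: "r (p + \<zeta> *s v) \<le> \<epsilon> * \<bar>x\<bar> * \<eta> - c * \<bar>x\<bar> ^ l - 2 * \<eta> * (\<epsilon> * h)"
        using 1 by linarith
      \<comment> \<open>For \<open>\<bar>x\<bar> \<le> h\<close> the tangential cost is at most
        \<open>\<eta> * h ^ l\<close>, half of the shift's gain. For larger
        \<open>\<bar>x\<bar>\<close> one has
        \<open>\<epsilon> \<le> \<bar>x\<bar> ^ (l - 1)\<close>, and the leading term pays for
        it.\<close>
      have "\<epsilon> * \<bar>x\<bar> * \<eta> - c * \<bar>x\<bar> ^ l \<le> \<eta> * (\<epsilon> * h)"
      proof (cases "\<bar>x\<bar> \<le> h")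
        case True
        then have "\<epsilon> * \<bar>x\<bar> * \<eta> \<le> \<epsilon> * h * \<eta>"
          using \<epsilon> \<eta> by (intro mult_right_mono mult_left_mono) auto
        moreover have "0 \<le> c * \<bar>x\<bar> ^ l"
          using assms(3) by simp
        ultimately show ?thesis
          by (simp add: algebra_simps)
      next
        case False
        have "\<epsilon> * \<bar>x\<bar> * \<eta> \<le> \<bar>x\<bar> ^ (l - 1) * \<bar>x\<bar> * c"
          unfolding \<epsilon>_def using False h0 \<eta> by (intro mult_mono power_mono) auto
        also have "\<dots> = c * \<bar>x\<bar> ^ l"
          using assms(2) by (simp add: power_eq_if)
        finally show ?thesis
          using \<eta>(1) \<epsilon>(1) h0 by (smt (verit) mult_pos_pos)
      qed
      moreover have "0 < \<eta> * (\<epsilon> * h)"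
        using \<eta>(1) \<epsilon>(1) h0 by simp
      ultimately have "r (p + \<zeta> *s v) < 0"
        using r by linarith
      then show "\<zeta> \<in> \<Omega>"
        unfolding \<Omega>_def using D_iff near(1)[OF cx] \<delta>(2) by blast
    qed
    have out: "\<i> * of_real (\<sigma> * (k * h)) \<notin> \<Omega>"
    proof -
      define \<zeta> where "\<zeta> = \<i> * complex_of_real (\<sigma> * (k * h))"
      have c\<zeta>: "cmod \<zeta> = k * h"
        unfolding \<zeta>_def using \<sigma> k h0 by (auto simp: norm_mult)
      have "k * h \<le> 1 * h"
        using k h0 by (intro mult_right_mono) auto
      then have cs: "cmod \<zeta> \<le> s0"
        using c\<zeta> h(3) by linarith
      define y0 where "y0 = a + \<zeta> *s Y"
      \<comment> \<open>The two factors \<open>\<sigma>\<close> cancel and \<open>\<i>\<close> times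
        \<open>- \<i>\<close> is 1, so the tilt moves this point outward along \<open>g\<close> for
        either sign.\<close>
      have "\<zeta> * u = of_real (\<epsilon> * k * h)"
        unfolding \<zeta>_def u_def using \<sigma> by (auto simp: complex_eq_iff)
      then have pv_eq: "p + \<zeta> *s v = y0 + (\<epsilon> * k * h - t) *\<^sub>R g"
        unfolding pv y0_def by (simp only: of_real_vector_smult) (simp add: algebra_simps)
      have pos: "0 < k * (\<epsilon> * h)"
        using k(1) \<epsilon>(1) h0 by simp
      have "\<tau> * (\<epsilon> * h) \<le> k / 4 * (\<epsilon> * h)"
        using \<tau>(2) \<epsilon>(1) h0 by (intro mult_right_mono) auto
      moreover have "\<epsilon> * k * h - t = k * (\<epsilon> * h) - \<tau> * (\<epsilon> * h)"
        unfolding t_def hl by simp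
      ultimately have gain: "3 / 4 * k * (\<epsilon> * h) \<le> \<epsilon> * k * h - t"
        by linarith
      have "0 \<le> \<epsilon> * k * h - t"
        using gain pos by linarith
      then have "(\<epsilon> * k * h - t) * (G / 2) \<le> r (p + \<zeta> *s v) - r y0"
        using \<delta>(3)[of y0 "\<epsilon> * k * h - t"] near[OF cs] unfolding y0_def pv_eq by simp
      moreover have "3 / 4 * k * (\<epsilon> * h) * (G / 2) \<le> (\<epsilon> * k * h - t) * (G / 2)"
        using gain \<open>G > 0\<close> by (intro mult_right_mono) auto
      \<comment> \<open>In units of \<open>G * (k * (\<epsilon> * h))\<close>: the net outward
        displacement raises \<open>r\<close> by at least 3/8, and the starting value
        \<open>r y0\<close> is at least - 1/8.\<close>
      moreover have "- (G / 8 * (k * (\<epsilon> * h))) \<le> r y0"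
      proof -
        have "\<bar>r y0\<bar> \<le> C * (k * h) ^ l"
          using bound[of \<zeta>] cs s0(2) c\<zeta> unfolding y0_def by simp
        also have "\<dots> = C * (k ^ l * (\<epsilon> * h))"
          by (simp add: power_mult_distrib hl)
        also have "\<dots> \<le> C * (k ^ 2 * (\<epsilon> * h))"
          using assms(2,4) k \<epsilon>(1) h0 by (intro mult_left_mono mult_right_mono power_decreasing) auto
        also have "\<dots> = C * k * (k * (\<epsilon> * h))"
          by (simp add: power2_eq_square)
        also have "\<dots> \<le> G / 8 * (k * (\<epsilon> * h))"
          using k(3) pos by (intro mult_right_mono) auto
        finally show ?thesis
          by linarith
      qed
      ultimately have "1 / 4 * (G * (k * (\<epsilon> * h))) \<le> r (p + \<zeta> *s v)"
        by (simp add: algebra_simps)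
      then have "0 < r (p + \<zeta> *s v)"
        using mult_pos_pos[OF \<open>G > 0\<close> pos] by linarith
      then show ?thesis
        unfolding \<Omega>_def \<zeta>_def[symmetric] using D_iff[of "p + \<zeta> *s v"] near(1)[OF cs] \<delta>(2) by auto
    qed
    have "simply_connected \<Omega>"
      unfolding \<Omega>_def
      by (rule simply_connected_line_parameters[OF assms(1) \<open>v \<noteq> 0\<close>, of _ "of_real s0"])
         (use subsetD[OF seg_in ends_in_segment(2)] in \<open>simp add: \<Omega>_def\<close>)
    then show ?thesis
      using \<gamma> seg_in \<gamma>_in out
      by (intro simply_connected_imp_winding_number_zero[of \<Omega>]) (auto simp: path_image_join)
  qed
  have kh: "0 < k * h" "k * h < h"
    using k h0 mult_right_mono[OF k(2), of h] by auto
  have "k * h < cmod z" if "z \<in> path_image \<gamma>" for z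
  proof -
    have "z \<notin> ball 0 m"
      using that m(2) by blast
    then show ?thesis
      using kh h(2) by simp
  qed
  then show False
    using winding_number_crossing[OF \<gamma>(1,3,4) s0(1), of "k * h"] winding[of 1] winding[of "- 1"] kh h(3)
    by simp
qed

end

section \<open>From the defining function to the two-sided estimate\<close>

text \<open>That \<open>r\<close> vanishes at \<open>a\<close> has to be derived: a negative value
  would put \<open>a\<close> into the open set \<open>D\<close>, a positive one would persist near
  \<open>a\<close> and contradict that \<open>a\<close> is in the closure of
  \<open>D\<close>.\<close>

lemma smooth_boundary_point_of_local_defining_function:
  assumes "open D" "a \<in> frontier D" "local_defining_function D a r"
  shows "\<exists>V g. smooth_boundary_point D V a g r"
proof -
  obtain V where V: "open V" "a \<in> V" "smooth_on V r" "D \<inter> V = {z \<in> V. r z < 0}"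
    and nz: "frechet_derivative r (at a) \<noteq> (\<lambda>_. 0)"
    using assms(3) unfolding local_defining_function_def by blast
  have D_iff: "z \<in> D \<longleftrightarrow> r z < 0" if "z \<in> V" for z
    using V(4) that by blast
  have "a \<notin> D"
    using assms(1,2) by (simp add: frontier_def interior_open)
  have "\<not> 0 < r a"
  proof
    assume "0 < r a"
    have "continuous_on V r"
      using smooth_on_isCont[OF V(3)] by (simp add: continuous_at_imp_continuous_on)
    then have "open (V \<inter> r -` {0<..})"
      using V(1) by (rule continuous_open_preimage) simp
    moreover have "a \<in> V \<inter> r -` {0<..}" "a \<in> closure D"
      using V(2) \<open>0 < r a\<close> assms(2) by (auto simp: frontier_def)
    ultimately have "V \<inter> r -` {0<..} \<inter> D \<noteq> {}"
      using open_Int_closure_eq_empty by blast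
    then obtain z where "z \<in> D" "z \<in> V" "0 < r z"
      by auto
    then show False
      using D_iff by fastforce
  qed
  then have "r a = 0"
    using D_iff[OF V(2)] \<open>a \<notin> D\<close> by simp
  \<comment> \<open>The Riesz representative of the derivative, obtained as its adjoint applied to
    1.\<close>
  define g where "g = adjoint (frechet_derivative r (at a)) 1"
  have D: "(r has_derivative frechet_derivative r (at a)) (at a)"
    using smooth_on_has_derivative V by blast
  have fd: "frechet_derivative r (at a) = (\<lambda>h. h \<bullet> g)"
    using adjoint_works[OF has_derivative_linear[OF D], of _ 1] unfolding g_def by (auto simp: fun_eq_iff)
  then have "GDERIV r a :> g"
    using D unfolding gderiv_def by simp
  moreover have "g \<noteq> 0"
    using nz fd by auto
  ultimately have "smooth_boundary_point D V a g r"
    using assms(1,2) V(1-3) D_iff \<open>r a = 0\<close> by unfold_locales auto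
  then show ?thesis
    by blast
qed

lemma (in smooth_boundary_point) inner_normal_eq: "inner_normal r a = {a - t *\<^sub>R g | t. 0 \<le> t}"
proof -
  have "g' = g" if "GDERIV r a :> g'" for g'
  proof -
    have "(\<lambda>h. h \<bullet> g') = (\<lambda>h. h \<bullet> g)"
      using that gradient has_derivative_unique unfolding gderiv_def by blast
    then show ?thesis
      by (metis vector_eq_ldot)
  qed
  then show ?thesis
    unfolding inner_normal_def using gradient by blast
qed

text \<open>The upper bound is the Taylor estimate; C-convexity enters in the lower bound, where it
  excludes even order with a negative leading coefficient.\<close>

lemma (in smooth_boundary_point) contact_bounds:
  assumes "C_convex_domain D" "contact_order r a X = enat l"
  shows "0 < l"
    and "\<exists>C\<ge>0. \<exists>d>0. \<forall>\<zeta>. cmod \<zeta> < d \<longrightarrow> \<bar>r (a + \<zeta> *s X)\<bar> \<le> C * cmod \<zeta> ^ l"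
    and "\<exists>c>0. \<exists>d>0. \<exists>w. \<forall>s. 0 \<le> s \<and> s < d \<longrightarrow> c * s ^ l \<le> r (a + (of_real s * w) *s X)"
proof -
  define f where "f = (\<lambda>\<zeta>. r (a + \<zeta> *s X))"
  define S where "S = (\<lambda>\<zeta>. a + \<zeta> *s X) -` V"
  have "open S"
    unfolding S_def by (rule open_vimage_affine[OF bounded_linear_vector_smult open_V])
  have "smooth_on S f"
    unfolding S_def f_def by (rule smooth_on_affine[OF open_V smooth bounded_linear_vector_smult])
  have "0 \<in> S"
    unfolding S_def using a_V by simp
  have order: "vanishing_order f 0 = enat l"
    using assms(2) unfolding contact_order_def f_def .
  note low = vanishing_order_eq_enatD(2)[OF order]
  obtain vs where vs: "length vs = l" "iter_deriv vs f 0 \<noteq> 0"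
    using vanishing_order_eq_enatD(1)[OF order] by blast
  show "0 < l"
  proof (rule ccontr)
    assume "\<not> 0 < l"
    then show False
      using vs r_a unfolding f_def by simp
  qed
  obtain C d where Cd: "0 \<le> C" "0 < d" "\<And>\<zeta>. cmod \<zeta> < d \<Longrightarrow> \<bar>f \<zeta>\<bar> \<le> C * cmod \<zeta> ^ l"
    using abs_le_power_of_iter_deriv_zero[OF \<open>open S\<close> \<open>smooth_on S f\<close> \<open>0 \<in> S\<close>, of l] low by auto
  then show "\<exists>C\<ge>0. \<exists>d>0. \<forall>\<zeta>. cmod \<zeta> < d \<longrightarrow> \<bar>r (a + \<zeta> *s X)\<bar> \<le> C * cmod \<zeta> ^ l"
    unfolding f_def by blast
  obtain w where w: "iter_deriv (replicate l w) f 0 \<noteq> 0"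
    using iter_deriv_polarization[OF \<open>open S\<close> \<open>smooth_on S f\<close> \<open>0 \<in> S\<close>, of vs] vs by auto
  define A where "A = iter_deriv (replicate l w) f 0"
  \<comment> \<open>With this tolerance the coefficient \<open>B\<close> keeps the sign of
    \<open>A\<close> and has absolute value at least \<open>\<bar>A\<bar> / 2\<close>.\<close>
  have "0 < \<bar>A\<bar> / 2"
    using w unfolding A_def by simp
  then have "\<exists>d>0. \<forall>s. \<bar>s\<bar> < d \<longrightarrow> (\<exists>B. \<bar>B - A\<bar> < \<bar>A\<bar> / 2 \<and> f (0 + s *\<^sub>R w) = B / fact l * s ^ l)"
    unfolding A_def by (intro leading_term_line[OF \<open>open S\<close> \<open>smooth_on S f\<close> \<open>0 \<in> S\<close>] low)
  then obtain d1 where d1: "d1 > 0"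
    "\<And>s. \<bar>s\<bar> < d1 \<Longrightarrow> \<exists>B. \<bar>B - A\<bar> < \<bar>A\<bar> / 2 \<and> f (of_real s * w) = B / fact l * s ^ l"
    by (auto simp: scaleR_conv_of_real)
  define c where "c = \<bar>A\<bar> / 2 / fact l"
  have "c > 0"
    unfolding c_def using \<open>0 < \<bar>A\<bar> / 2\<close> by simp
  have pos: "c * s ^ l \<le> f (of_real s * w)" if s: "\<bar>s\<bar> < d1" "0 < A" "0 \<le> s ^ l" for s
  proof -
    obtain B where B: "\<bar>B - A\<bar> < \<bar>A\<bar> / 2" "f (of_real s * w) = B / fact l * s ^ l"
      using d1(2)[OF s(1)] by blast
    have "\<bar>A\<bar> / 2 \<le> B"
      using B(1) s(2) by linarith
    then show ?thesis
      unfolding B(2) c_def using s(3) by (intro mult_right_mono divide_right_mono) auto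
  qed
  have neg: "f (of_real s * w) \<le> - (c * s ^ l)" if s: "\<bar>s\<bar> < d1" "A < 0" "0 \<le> s ^ l" for s
  proof -
    obtain B where B: "\<bar>B - A\<bar> < \<bar>A\<bar> / 2" "f (of_real s * w) = B / fact l * s ^ l"
      using d1(2)[OF s(1)] by blast
    have "B \<le> - (\<bar>A\<bar> / 2)"
      using B(1) s(2) by linarith
    then have "B / fact l * s ^ l \<le> - (\<bar>A\<bar> / 2) / fact l * s ^ l"
      using s(3) by (intro mult_right_mono divide_right_mono) auto
    then show ?thesis
      unfolding B(2) c_def by simp
  qed
  show "\<exists>c>0. \<exists>d>0. \<exists>w. \<forall>s. 0 \<le> s \<and> s < d \<longrightarrow> c * s ^ l \<le> r (a + (of_real s * w) *s X)"
  proof (cases "A > 0")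
    case True
    then have "\<forall>s. 0 \<le> s \<and> s < d1 \<longrightarrow> c * s ^ l \<le> r (a + (of_real s * w) *s X)"
      using pos unfolding f_def by simp
    then show ?thesis
      using \<open>c > 0\<close> d1(1) by blast
  next
    case False
    then have "A < 0"
      using \<open>0 < \<bar>A\<bar> / 2\<close> by simp
    show ?thesis
    proof (cases "even l")
      \<comment> \<open>Now \<open>s ^ l = \<bar>s\<bar> ^ l\<close>, so the negative bound holds on
        both sides of 0 along \<open>w *s X\<close>, which is impossible.\<close>
      case True
      then have "2 \<le> l"
        using \<open>0 < l\<close> by (auto elim!: evenE)
      define d' where "d' = min d1 (d / (cmod w + 1))"
      have "d' > 0"
        unfolding d'_def using d1(1) Cd(2) by (simp add: add_nonneg_pos)
      have "r (a + of_real s *s (w *s X)) \<le> - c * \<bar>s\<bar> ^ l" if "\<bar>s\<bar> < d'" for s :: real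
        using neg[of s] that True \<open>A < 0\<close> unfolding d'_def f_def by (simp add: power_even_abs zero_le_even_power)
      moreover have "\<bar>r (a + \<zeta> *s (w *s X))\<bar> \<le> C * cmod w ^ l * cmod \<zeta> ^ l" if "cmod \<zeta> < d'" for \<zeta>
      proof -
        have "cmod \<zeta> < d / (cmod w + 1)"
          using that unfolding d'_def by simp
        then have "cmod \<zeta> * (cmod w + 1) < d"
          by (simp add: pos_less_divide_eq add_nonneg_pos)
        moreover have "cmod \<zeta> * cmod w \<le> cmod \<zeta> * (cmod w + 1)"
          by (intro mult_left_mono) auto
        ultimately have "cmod (\<zeta> * w) < d"
          by (simp add: norm_mult)
        from Cd(3)[OF this] show ?thesis
          unfolding f_def by (simp add: norm_mult power_mult_distrib mult_ac)
      qed
      moreover have "0 \<le> C * cmod w ^ l"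
        using Cd(1) by simp
      ultimately have False
        using C_convex_not_negative_tangentially[OF assms(1) \<open>2 \<le> l\<close> \<open>c > 0\<close> _ \<open>d' > 0\<close>] by blast
      then show ?thesis ..
    next
      \<comment> \<open>For odd \<open>l\<close> the leading term changes sign with
        \<open>s\<close>, so \<open>- w\<close> is the required direction.\<close>
      case False
      have "c * s ^ l \<le> f (of_real s * - w)" if s: "0 \<le> s" "s < d1" for s
      proof -
        obtain B where B: "\<bar>B - A\<bar> < \<bar>A\<bar> / 2" "f (of_real (- s) * w) = B / fact l * (- s) ^ l"
          using d1(2)[of "- s"] s by auto
        have "\<bar>A\<bar> / 2 \<le> - B"
          using B(1) \<open>A < 0\<close> by linarith
        then have "\<bar>A\<bar> / 2 / fact l * s ^ l \<le> - B / fact l * s ^ l"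
          using s(1) by (intro mult_right_mono divide_right_mono) auto
        then show ?thesis
          using B(2) False unfolding c_def by (simp add: power_minus_odd)
      qed
      then show ?thesis
        using \<open>c > 0\<close> d1(1) unfolding f_def by blast
    qed
  qed
qed

theorem proposition4:
  fixes D :: "(complex ^ 'n) set" and a X :: "complex ^ 'n"
    and r :: "complex ^ 'n \<Rightarrow> real" and l :: nat
  assumes "C_convex_domain D"
    and "a \<in> frontier D"
    and "local_defining_function D a r"
    and "X \<noteq> 0"
    and "contact_order r a X = enat l"
  shows "\<exists>U c. open U \<and> a \<in> U \<and> 1 < c \<and>
    (\<forall>z \<in> D \<inter> U \<inter> inner_normal r a.
       ereal (inverse c * boundary_dist D z) \<le> directional_dist D z X ^ l \<and>
       directional_dist D z X ^ l \<le> ereal (c * boundary_dist D z))"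
proof -
  have "open D"
    using assms(1) unfolding C_convex_domain_def by blast
  then obtain V g where "smooth_boundary_point D V a g r"
    using smooth_boundary_point_of_local_defining_function assms(2,3) by blast
  then interpret smooth_boundary_point D V a g r .
  note contact = contact_bounds[OF assms(1,5)]
  define n where "n = norm g"
  have "n > 0"
    unfolding n_def using g_nz by simp
  obtain e1 where e1: "e1 > 0" "\<And>t. \<lbrakk>0 < t; t < e1\<rbrakk> \<Longrightarrow>
      n / 4 * t \<le> boundary_dist D (a - t *\<^sub>R g) \<and> boundary_dist D (a - t *\<^sub>R g) \<le> n * t"
    using boundary_dist_inner_normal unfolding n_def by blast
  obtain C d where Cd: "0 \<le> C" "0 < d" "\<And>\<zeta>. cmod \<zeta> < d \<Longrightarrow> \<bar>r (a + \<zeta> *s X)\<bar> \<le> C * cmod \<zeta> ^ l"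
    using contact(2) by blast
  from disc_in_domain[OF contact(1) Cd(1,2) abs_le_D1[OF Cd(3)]]
  obtain c1 e2 where e2: "c1 > 0" "e2 > 0" "\<And>t. \<lbrakk>0 < t; t < e2\<rbrakk> \<Longrightarrow>
      \<exists>\<rho>>0. \<rho> ^ l = c1 * t \<and> (\<forall>\<zeta>. cmod \<zeta> < \<rho> \<longrightarrow> a - t *\<^sub>R g + \<zeta> *s X \<in> D)"
    by blast
  obtain c0 d0 w where c0: "c0 > 0" "d0 > 0" "\<And>s. \<lbrakk>0 \<le> s; s < d0\<rbrakk> \<Longrightarrow> c0 * s ^ l \<le> r (a + (of_real s * w) *s X)"
    using contact(3) by blast
  from disc_radius_bound[OF contact(1) c0]
  obtain c2 e3 where e3: "c2 > 0" "e3 > 0" "\<And>t \<rho>. \<lbrakk>0 < t; t < e3; 0 < \<rho>;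
      \<And>\<zeta>. cmod \<zeta> < \<rho> \<Longrightarrow> a - t *\<^sub>R g + \<zeta> *s X \<in> D\<rbrakk> \<Longrightarrow> \<rho> ^ l \<le> c2 * t"
    by blast
  \<comment> \<open>The boundary distance lies between \<open>n / 4 * t\<close> and
    \<open>n * t\<close>, the power of the directional distance between \<open>c1 * t\<close> and
    \<open>c2 * t\<close>; eliminating \<open>t\<close> produces these two ratios, and 2 ensures
    \<open>1 < c\<close>.\<close>
  define c where "c = 2 + n / c1 + 4 * c2 / n"
  define e where "e = min e1 (min e2 e3)"
  have e: "e > 0" "e \<le> e1" "e \<le> e2" "e \<le> e3"
    unfolding e_def using e1(1) e2(2) e3(2) by auto
  have c: "1 < c" "n / c1 \<le> c" "4 * c2 / n \<le> c"
    unfolding c_def using \<open>n > 0\<close> e2(1) e3(1) by (auto simp: add_pos_pos intro!: add_pos_pos)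
  have "ereal (inverse c * boundary_dist D z) \<le> directional_dist D z X ^ l \<and>
      directional_dist D z X ^ l \<le> ereal (c * boundary_dist D z)"
    if z: "z \<in> D \<inter> ball a (e * n) \<inter> inner_normal r a" for z
  proof -
    obtain t where zt: "z = a - t *\<^sub>R g" "0 \<le> t"
      using z unfolding inner_normal_eq by blast
    have "a \<notin> D"
      using D_iff[OF a_V] r_a by simp
    then have t0: "0 < t"
      using z zt by (cases "t = 0") auto
    have "t * n < e * n"
      using z zt unfolding n_def by (simp add: dist_norm)
    then have te: "t < e"
      using \<open>n > 0\<close> by simp
    define b where "b = boundary_dist D z"
    have b: "n / 4 * t \<le> b" "b \<le> n * t"
      using e1(2)[of t] t0 te e(2) unfolding b_def zt(1) by auto
    define R where "R = {\<rho>. 0 < \<rho> \<and> (\<forall>\<mu>. cmod \<mu> < \<rho> \<longrightarrow> z + \<mu> *s X \<in> D)}"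
    have E: "directional_dist D z X = Sup (ereal ` R)"
      unfolding directional_dist_def R_def ..
    obtain \<rho> where \<rho>: "\<rho> > 0" "\<rho> ^ l = c1 * t" "\<rho> \<in> R"
      using e2(3)[of t] t0 te e(3) unfolding R_def zt(1) by auto
    define \<rho>' where "\<rho>' = root l (c2 * t)"
    have \<rho>': "0 \<le> \<rho>'" "\<rho>' ^ l = c2 * t"
      unfolding \<rho>'_def using contact(1) e3(1) t0 by auto
    have "x \<le> \<rho>'" if "x \<in> R" for x
    proof -
      have "x ^ l \<le> \<rho>' ^ l"
        unfolding \<rho>'(2) using that e3(3)[of t x] t0 te e(4) unfolding R_def zt(1) by auto
      moreover have "0 \<le> x"
        using that unfolding R_def by simp
      ultimately show ?thesis
        using \<rho>'(1) contact(1) power_mono_iff by blast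
    qed
    then have "directional_dist D z X \<le> ereal \<rho>'"
      unfolding E by (auto intro: Sup_least)
    moreover have "ereal \<rho> \<le> directional_dist D z X"
      unfolding E using \<rho>(3) by (auto intro: Sup_upper)
    \<comment> \<open>Bounded on both sides by reals, the extended supremum is itself real, and
      powers can be compared in the reals.\<close>
    ultimately obtain x where x: "directional_dist D z X = ereal x" "\<rho> \<le> x" "x \<le> \<rho>'"
      by (cases "directional_dist D z X") auto
    have "c1 * t \<le> x ^ l" "x ^ l \<le> c2 * t"
      unfolding \<rho>(2)[symmetric] \<rho>'(2)[symmetric] using x \<rho>(1) by (auto intro!: power_mono)
    moreover have "inverse c * b \<le> c1 * t"
    proof -
      have "b \<le> (n / c1) * (c1 * t)"
        using b(2) e2(1) by simp
      also have "\<dots> \<le> c * (c1 * t)"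
        using c(2) e2(1) t0 by (intro mult_right_mono) auto
      finally show ?thesis
        using c(1) by (simp add: field_simps)
    qed
    moreover have "c2 * t \<le> c * b"
    proof -
      have "c2 * t = (4 * c2 / n) * (n / 4 * t)"
        using \<open>n > 0\<close> by simp
      also have "\<dots> \<le> c * b"
        using b(1) c \<open>n > 0\<close> t0 by (intro mult_mono) auto
      finally show ?thesis .
    qed
    ultimately show ?thesis
      unfolding x(1) b_def[symmetric] by simp
  qed
  then show ?thesis
    \<comment> \<open>On the normal the distance to \<open>a\<close> is \<open>t * n\<close>, so
      this ball amounts to \<open>t < e\<close>.\<close>
    using c(1) e(1) \<open>n > 0\<close> by (intro exI[of _ "ball a (e * n)"] exI[of _ c]) auto
qed

end
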